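(* Let $n\ge 1$ and $1\le k\le n$ be integers, let $p>1$ be a real number with $pk<n$, let $\alpha\in\mathbb R$, and put $k_{p,*}:=\frac{n(p-1)k}{n-pk}$. Then the differential inequality $$F_{k,p}[u]\ \ge\ (-u)^\alpha\quad\text{in }\mathbb R^n$$ has no negative solution $u\in\Phi^{p,k}(\mathbb R^n)$ (that is, there is no $u\in\Phi^{p,k}(\mathbb R^n)$ with $u<0$ everywhere in $\mathbb R^n$ satisfying the inequality at every point of $\mathbb R^n$) if and only if $\alpha\le k_{p,*}$.
   Context: For $\lambda\in\mathbb R^n$, $\sigma_l(\lambda)=\sum_{1\le i_1<\cdots<i_l\le n}\lambda_{i_1}\cdots\lambda_{i_l}$ is the $l$-th elementary symmetric polynomial, and $\Gamma_k:=\{\lambda\in\mathbb R^n \mid \sigma_l(\lambda)\ge 0,\ l=1,\dots,k\}$. For a function $u$, the vector field $|Du|^{p-2}Du$ is understood to be $0$ where $Du=0$, and $D(|Du|^{p-2}Du)$ denotes its Jacobian matrix, with $(i,j)$ entry $\partial_j(|Du|^{p-2}\partial_i u)$. For a matrix $A$, $\lambda(A)$ denotes its $n$-tuple of eigenvalues; writing $\lambda(A)\in\Gamma_k$ includes that the eigenvalues are real. The $p$-$k$-Hessian operator is $F_{k,p}[u]:=\sigma_k\big(\lambda(D(|Du|^{p-2}Du))\big)$, equivalently the sum of the $k\times k$ principal minors of $D(|Du|^{p-2}Du)$. For a domain $\Omega\subset\mathbb R^n$, the class of $p$-$k$-admissible functions is $$\Phi^{p,k}(\Omega):=\big\{u\in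 C^1(\Omega)\ \big|\ |Du|^{p-2}Du\in C^1(\Omega),\ \lambda\big(D(|Du|^{p-2}Du)(x)\big)\in\Gamma_k\ \ \forall x\in\Omega\big\}.$$ *)

theory Defs
  imports "HOL-Analysis.Analysis" "HOL-Computational_Algebra.Computational_Algebra"
begin

definition elem_sym :: "nat \<Rightarrow> 'a::comm_ring_1 ^ 'n \<Rightarrow> 'a" where
  "elem_sym l \<mu> = (\<Sum>I | I \<subseteq> (UNIV :: 'n set) \<and> card I = l. \<Prod>i\<in>I. \<mu> $ i)"

definition Gamma_cone :: "nat \<Rightarrow> (real ^ 'n) set" where
  "Gamma_cone k = {\<mu>. \<forall>l\<in>{1..k}. elem_sym l \<mu> \<ge> 0}"

definition charpoly :: "'a::comm_ring_1 ^ 'n ^ 'n \<Rightarrow> 'a poly" where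
  "charpoly A = det (\<chi> i j. if i = j then [:- (A $ i $ j), 1:] else [:- (A $ i $ j):])"

definition complex_mat :: "real ^ 'n ^ 'n \<Rightarrow> complex ^ 'n ^ 'n" where
  "complex_mat A = (\<chi> i j. complex_of_real (A $ i $ j))"

(* The n-tuple of complex eigenvalues, repeated according to algebraic multiplicity. It is
   determined up to permutation; all uses below are invariant under permutations. *)
definition eigvals :: "real ^ 'n ^ 'n \<Rightarrow> complex ^ 'n" where
  "eigvals A = (SOME \<mu>. charpoly (complex_mat A) = (\<Prod>i\<in>UNIV. [:- (\<mu> $ i), 1:]))"

lemma charpoly_monic:
  fixes A :: "'a::idom ^ 'n ^ 'n"
  shows "degree (charpoly A) = CARD('n)" "lead_coeff (charpoly A) = 1"
proof -
  define M where "M = (\<chi> i j. if i = j then [:- (A $ i $ j), 1:] else [:- (A $ i $ j):])"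
  define T where "T = (\<lambda>q. of_int (sign q) * (\<Prod>i\<in>(UNIV :: 'n set). M $ i $ q i))"
  have degM: "degree (M $ i $ j) = (if i = j then 1 else 0)" for i j
    by (simp add: M_def)
  have small: "degree (T q) < CARD('n)" if "q \<noteq> id" for q
  proof -
    from that obtain i0 where i0: "q i0 \<noteq> i0" by (auto simp: fun_eq_iff)
    have "degree (T q) \<le> degree (\<Prod>i\<in>UNIV. M $ i $ q i)"
      by (simp add: T_def sign_def)
    also have "\<dots> \<le> (\<Sum>i\<in>UNIV. degree (M $ i $ q i))"
      using degree_prod_sum_le[of UNIV "\<lambda>i. M $ i $ q i"] by simp
    also have "\<dots> < (\<Sum>i\<in>(UNIV :: 'n set). 1)"
      by (rule sum_strict_mono_ex1) (use i0 in \<open>auto simp: degM intro!: exI[of _ i0]\<close>)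
    finally show ?thesis by simp
  qed
  have Tid: "T id = (\<Prod>i\<in>UNIV. [:- (A $ i $ i), 1:])"
    by (simp add: T_def M_def)
  have degid: "degree (T id) = CARD('n)"
    unfolding Tid by (subst degree_prod_sum_eq) auto
  have lcid: "lead_coeff (T id) = 1"
    unfolding Tid by (subst lead_coeff_prod) auto
  have fin: "finite {q. q permutes (UNIV :: 'n set)}"
    by simp
  define R where "R = sum T ({q. q permutes (UNIV :: 'n set)} - {id})"
  have "charpoly A = sum T {q. q permutes (UNIV :: 'n set)}"
    by (simp add: charpoly_def det_def T_def M_def)
  also have "\<dots> = T id + R"
    unfolding R_def by (rule sum.remove) (auto simp: permutes_id fin)
  finally have eq: "charpoly A = T id + R" .
  have R: "degree R < CARD('n)"
    unfolding R_def by (rule degree_sum_less) (auto intro: small)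
  show "degree (charpoly A) = CARD('n)"
    unfolding eq using R degid by (simp add: degree_add_eq_left)
  then show "lead_coeff (charpoly A) = 1"
    using lcid degid R by (simp add: eq coeff_eq_0)
qed

lemma charpoly_eigvals:
  "charpoly (complex_mat A) = (\<Prod>i\<in>UNIV. [:- (eigvals A $ i), 1:])"
  for A :: "real ^ 'n ^ 'n"
proof -
  let ?c = "charpoly (complex_mat A)"
  obtain root where root: "smult (lead_coeff ?c) (\<Prod>i<degree ?c. [:- root i, 1:]) = ?c"
    using complex_poly_decompose' by blast
  obtain h where h: "bij_betw h (UNIV :: 'n set) {..<CARD('n)}"
    using finite_same_card_bij[of "UNIV :: 'n set" "{..<CARD('n)}"] by auto
  have "?c = (\<Prod>i<CARD('n). [:- root i, 1:])"
    using root unfolding charpoly_monic(2) unfolding charpoly_monic(1) by simp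
  also have "\<dots> = (\<Prod>i\<in>UNIV. [:- ((\<chi> i. root (h i)) $ i), 1:])"
    using prod.reindex_bij_betw[OF h, of "\<lambda>i. [:- root i, 1:]"] by simp
  finally show ?thesis
    unfolding eigvals_def by (rule someI)
qed

(* "\<lambda>(A) \<in> S", for a permutation-invariant set S of real tuples *)
definition eigvals_in :: "real ^ 'n ^ 'n \<Rightarrow> (real ^ 'n) set \<Rightarrow> bool" where
  "eigvals_in A S \<longleftrightarrow> (\<exists>\<mu>\<in>S. eigvals A = (\<chi> i. complex_of_real (\<mu> $ i)))"

definition C1_on :: "('a::real_normed_vector \<Rightarrow> 'b::real_normed_vector) \<Rightarrow> 'a set \<Rightarrow> bool" where
  "C1_on f \<Omega> \<longleftrightarrow> (\<exists>f' :: 'a \<Rightarrow> 'a \<Rightarrow>\<^sub>L 'b.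
     (\<forall>x\<in>\<Omega>. (f has_derivative blinfun_apply (f' x)) (at x)) \<and> continuous_on \<Omega> f')"

definition grad :: "(real ^ 'n \<Rightarrow> real) \<Rightarrow> real ^ 'n \<Rightarrow> real ^ 'n" where
  "grad u x = (\<chi> i. frechet_derivative u (at x) (axis i 1))"

(* Where Du = 0 this is 0, whatever the value of 0 powr (p - 2). *)
definition p_field :: "real \<Rightarrow> (real ^ 'n \<Rightarrow> real) \<Rightarrow> real ^ 'n \<Rightarrow> real ^ 'n" where
  "p_field p u x = (norm (grad u x) powr (p - 2)) *\<^sub>R grad u x"

definition p_jacobian :: "real \<Rightarrow> (real ^ 'n \<Rightarrow> real) \<Rightarrow> real ^ 'n \<Rightarrow> real ^ 'n ^ 'n" where
  "p_jacobian p u x = jacobian (p_field p u) (at x)"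

(* The non-real eigenvalues of a real matrix come in conjugate pairs, so elem_sym k of its
   eigenvalues is a real number and Re only changes the type. *)
definition p_k_Hessian :: "nat \<Rightarrow> real \<Rightarrow> (real ^ 'n \<Rightarrow> real) \<Rightarrow> real ^ 'n \<Rightarrow> real" where
  "p_k_Hessian k p u x = Re (elem_sym k (eigvals (p_jacobian p u x)))"

(* Intended for open \<Omega>: derivatives are taken at interior points, and the values of u
   outside \<Omega> play no role. *)
definition admissible :: "real \<Rightarrow> nat \<Rightarrow> (real ^ 'n) set \<Rightarrow> (real ^ 'n \<Rightarrow> real) set" where
  "admissible p k \<Omega> = {u. C1_on u \<Omega> \<and> C1_on (p_field p u) \<Omega> \<and>
     (\<forall>x\<in>\<Omega>. eigvals_in (p_jacobian p u x) (Gamma_cone k))}"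

definition k_star :: "nat \<Rightarrow> nat \<Rightarrow> real \<Rightarrow> real" where
  "k_star n k p = real n * (p - 1) * real k / (real n - p * real k)"

end

theory Submission
  imports Defs
begin

text \<open>
  Put \<open>\<theta> = (n - p k) / ((p - 1) k)\<close>. The functions \<open>A - B |x - y|\<^sup>-\<^sup>\<theta>\<close> with \<open>B > 0\<close> are the
  increasing radial solutions of \<open>F = 0\<close> away from the pole \<open>y\<close>, and the critical exponent is the
  one with \<open>\<theta> k_* = n\<close>: it is the exponent for which \<open>(-u)\<^sup>\<alpha>\<close> decays exactly like \<open>|x|\<^sup>-\<^sup>n\<close> when
  \<open>-u\<close> decays like the fundamental solution.

  Nonexistence rests on comparison with radial powers \<open>v = A + B |x - y|\<^sup>q\<close>. Where \<open>u - v\<close> has a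
  local maximum and \<open>Dv \<noteq> 0\<close>, the gradients agree and \<open>D\<^sup>2u \<le> D\<^sup>2v\<close>. The Jacobian belonging to \<open>v\<close>
  has eigenvalues \<open>(a, b, ..., b)\<close> with \<open>a \<le> b\<close>, so no minimax theory is needed to order the
  spectra: every eigenvalue belonging to \<open>u\<close> is at most \<open>b\<close>, and minimising a Rayleigh quotient
  produces one which is at most \<open>a\<close>. Since \<open>\<sigma>_k\<close> increases in each variable on \<open>\<Gamma>_k\<close> (lemma
  \<open>esym_mono\<close>, a consequence of Newton's inequality), \<open>F[u] \<le> F[v]\<close> at that point
  (\<open>touching_radial_power\<close>). Hence \<open>u \<le> v\<close> on an annulus as soon as this holds on the boundary and
  \<open>F[u] > F[v]\<close> wherever \<open>u > v\<close> (\<open>comparison_radial_power\<close>). A ball may be used too, provided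
  that its centre \<open>y\<close> satisfies \<open>Du(y) \<noteq> 0\<close>, for then \<open>u - v\<close> cannot be maximal at the critical
  point \<open>y\<close> of \<open>v\<close>.

  At the points where \<open>u > v\<close> one has \<open>-u < -v\<close>, which is bounded by a multiple of \<open>-u(y)\<close> in all
  the applications. This reduces \<open>\<alpha> \<le> k_*\<close> to \<open>\<alpha> = k_*\<close> at the price of a constant. Now let \<open>m(r)\<close>
  be the minimum of \<open>-u\<close> on the ball of radius \<open>r\<close> about \<open>y\<close>, and \<open>h(r) = m(r) r\<^sup>\<theta>\<close>. Three
  comparison functions suffice. The exponent \<open>q = -\<theta>\<close> shows that \<open>h\<close> is nondecreasing (\<open>h_mono\<close>).
  The exponent \<open>q = p/(p-1)\<close>, for which \<open>F[v]\<close> is constant, gives \<open>m(R/2) \<ge> c m(R)\<^sup>\<beta> R\<^sup>q\<close> with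
  \<open>\<beta> = n/(n - p k) > 1\<close>, and therefore \<open>h\<close> is bounded (\<open>h_bounded\<close>). An exponent \<open>q\<close> slightly
  larger than \<open>-\<theta>\<close> makes \<open>F[v]\<close> a small multiple of \<open>|x - y|\<^sup>-\<^sup>n\<close> on a long annulus and yields
  \<open>h(L r) \<ge> (1 + \<eta>) h(r)\<close> with fixed \<open>L\<close> and \<open>\<eta> > 0\<close> (\<open>h_growth\<close>). The last two facts are
  incompatible.

  Existence for \<open>\<alpha> > k_*\<close> is explicit: with \<open>q = p/(p-1)\<close>, the function \<open>-\<epsilon> (1 + |x|\<^sup>q)\<^sup>-\<^sup>s\<close> with
  \<open>s \<alpha> = (s + 1) (p - 1) k\<close> and \<open>\<epsilon>\<close> small is a solution. The condition \<open>\<alpha> > k_*\<close> says precisely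
  that \<open>n - k (s + 1) p > 0\<close>, and this keeps \<open>\<sigma>_k\<close> from decaying faster than \<open>(1 + |x|\<^sup>q)\<close> to the
  power \<open>-s \<alpha>\<close>.
\<close>

section \<open>Elementary symmetric polynomials\<close>

definition esym :: "'i set \<Rightarrow> nat \<Rightarrow> ('i \<Rightarrow> 'a::comm_ring_1) \<Rightarrow> 'a" where
  "esym I l f = (\<Sum>J | J \<subseteq> I \<and> card J = l. \<Prod>i\<in>J. f i)"

lemma elem_sym_esym: "elem_sym l \<mu> = esym UNIV l (($) \<mu>)"
  by (simp add: elem_sym_def esym_def)

lemma esym_0: "finite I \<Longrightarrow> esym I 0 f = 1"
proof -
  assume "finite I"
  then have "{J. J \<subseteq> I \<and> card J = 0} = {{}}"
    by (auto dest: finite_subset)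
  then show ?thesis by (simp add: esym_def)
qed

lemma esym_empty_Suc: "esym {} (Suc l) f = 0"
proof -
  have none: "{J. J \<subseteq> {} \<and> card J = Suc l} = {}" by auto
  show ?thesis unfolding esym_def none by (rule sum.empty)
qed

lemma esym_insert:
  assumes "finite I" "i \<notin> I"
  shows "esym (insert i I) (Suc l) f = esym I (Suc l) f + f i * esym I l f"
proof -
  have split: "{J. J \<subseteq> insert i I \<and> card J = Suc l} =
      {J. J \<subseteq> I \<and> card J = Suc l} \<union> insert i ` {J. J \<subseteq> I \<and> card J = l}" (is "?L = ?A \<union> ?B")
  proof (intro set_eqI iffI)
    fix J assume J: "J \<in> ?L"
    show "J \<in> ?A \<union> ?B"
    proof (cases "i \<in> J")
      case True
      have "finite J" using J assms(1) finite_subset[of J "insert i I"] by auto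
      then have "J - {i} \<subseteq> I \<and> card (J - {i}) = l \<and> J = insert i (J - {i})"
        using J True by auto
      then show ?thesis by blast
    qed (use J in auto)
  next
    fix J assume "J \<in> ?A \<union> ?B"
    moreover have "J \<in> ?L" if "J \<in> ?B"
    proof -
      from that obtain J' where J': "J = insert i J'" "J' \<subseteq> I" "card J' = l" by auto
      then have "finite J'" "i \<notin> J'" using assms finite_subset by auto
      then show ?thesis using J' by auto
    qed
    ultimately show "J \<in> ?L" by auto
  qed
  have inj: "inj_on (insert i) {J. J \<subseteq> I \<and> card J = l}"
    using assms(2) by (auto simp: inj_on_def)
  have fin: "finite {J. J \<subseteq> I \<and> card J = m}" for m
    using assms(1) by simp
  have "esym (insert i I) (Suc l) f = (\<Sum>J\<in>?A. \<Prod>j\<in>J. f j) + (\<Sum>J\<in>?B. \<Prod>j\<in>J. f j)"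
    unfolding esym_def split
    by (rule sum.union_disjoint) (use assms fin in auto)
  also have "(\<Sum>J\<in>?B. \<Prod>j\<in>J. f j) = (\<Sum>J | J \<subseteq> I \<and> card J = l. \<Prod>j\<in>insert i J. f j)"
    by (simp add: sum.reindex[OF inj])
  also have "\<dots> = (\<Sum>J | J \<subseteq> I \<and> card J = l. f i * (\<Prod>j\<in>J. f j))"
    by (rule sum.cong) (use assms finite_subset in \<open>auto intro!: prod.insert\<close>)
  finally show ?thesis
    by (simp add: esym_def sum_distrib_left)
qed

text \<open>
  Vieta's formula in the normalisation \<open>\<Prod>(1 + f i X)\<close>, in which the degree of the coefficient is
  the degree of the symmetric polynomial and no correction by the number of variables appears.
\<close>
lemma coeff_prod_linear:
  assumes "finite I"
  shows "coeff (\<Prod>i\<in>I. [:1, f i:]) l = esym I l f"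
  using assms
proof (induction I arbitrary: l rule: finite_induct)
  case empty
  show ?case by (cases l) (auto simp: esym_0 esym_empty_Suc)
next
  case (insert i I)
  show ?case
    using insert by (cases l) (auto simp: esym_0 esym_insert)
qed

lemma esym_cong: "(\<And>i. i \<in> I \<Longrightarrow> f i = g i) \<Longrightarrow> esym I l f = esym I l g"
  unfolding esym_def by (intro sum.cong refl prod.cong) auto

lemma esym_const: "finite I \<Longrightarrow> esym I l (\<lambda>_. b) = of_nat (card I choose l) * b ^ l"
  by (simp add: esym_def n_subsets)

lemma esym_uminus: "esym I l (\<lambda>i. - f i) = (-1) ^ l * esym I l f"
  unfolding esym_def sum_distrib_left
  by (intro sum.cong refl) (auto simp: prod_uminus)

section \<open>Newton's inequality and monotonicity on the cone\<close>

text \<open>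
  Real-rootedness is phrased through complex roots, so that it passes to the derivative by the
  argument of Gauss and Lucas, without counting multiplicities in Rolle's theorem.
\<close>
definition real_rooted :: "real poly \<Rightarrow> bool" where
  "real_rooted f \<longleftrightarrow> (\<forall>z::complex. poly (map_poly of_real f) z = 0 \<longrightarrow> z \<in> \<real>)"

lemma map_poly_of_real_inj:
  assumes "map_poly complex_of_real f = map_poly complex_of_real g"
  shows "f = g"
proof (rule poly_eqI)
  fix m
  have "coeff (map_poly complex_of_real f) m = coeff (map_poly complex_of_real g) m"
    using assms by simp
  then show "coeff f m = coeff g m" by (simp add: coeff_map_poly)
qed

lemma map_poly_of_real_mult:
  "map_poly of_real (f * g) = map_poly of_real f * (map_poly of_real g :: complex poly)"
  by (rule poly_eqI) (simp add: coeff_map_poly coeff_mult)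

lemma map_poly_of_real_prod:
  "map_poly of_real (\<Prod>i\<in>I. f i) = (\<Prod>i\<in>I. map_poly of_real (f i) :: complex poly)"
  by (induction I rule: infinite_finite_induct) (auto simp: map_poly_of_real_mult)

lemma map_poly_of_real_pderiv:
  "map_poly of_real (pderiv f) = (pderiv (map_poly of_real f) :: complex poly)"
  by (rule poly_eqI) (simp add: coeff_map_poly coeff_pderiv)

lemma real_rooted_decompose:
  assumes "real_rooted f" "f \<noteq> 0"
  obtains \<rho> where "f = smult (lead_coeff f) (\<Prod>j<degree f. [:- \<rho> j, 1:])"
proof -
  let ?F = "map_poly of_real f :: complex poly"
  have deg: "degree ?F = degree f" and lc: "lead_coeff ?F = of_real (lead_coeff f)"
    by (auto simp: degree_map_poly coeff_map_poly)
  obtain root where root: "smult (lead_coeff ?F) (\<Prod>i<degree ?F. [:- root i, 1:]) = ?F"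
    using complex_poly_decompose' by blast
  define \<rho> where "\<rho> j = Re (root j)" for j
  have "root j = of_real (\<rho> j)" if "j < degree f" for j
  proof -
    have "poly ?F (root j) = 0"
      by (subst root[symmetric]) (use that in \<open>auto simp: poly_prod deg\<close>)
    then show ?thesis using assms(1) by (auto simp: real_rooted_def \<rho>_def)
  qed
  then have "?F = map_poly of_real (smult (lead_coeff f) (\<Prod>j<degree f. [:- \<rho> j, 1:]))"
    by (subst root[symmetric])
      (simp add: map_poly_smult map_poly_of_real_prod deg lc map_poly_pCons coeff_map_poly)
  then have "f = smult (lead_coeff f) (\<Prod>j<degree f. [:- \<rho> j, 1:])"
    by (rule map_poly_of_real_inj)
  then show ?thesis using that by blast
qed

text \<open>
  If all \<open>\<rho> j\<close> are real and \<open>z\<close> is not, then the imaginary part of every term of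
  \<open>f'(z)/f(z) = \<Sum> 1/(z - \<rho> j)\<close> has the sign opposite to that of \<open>Im z\<close>; so \<open>f'\<close> cannot vanish off
  the real axis.
\<close>
lemma real_rooted_pderiv:
  assumes "real_rooted f" "pderiv f \<noteq> 0"
  shows "real_rooted (pderiv f)"
  unfolding real_rooted_def
proof (intro allI impI, rule ccontr)
  fix z :: complex
  assume z0: "poly (map_poly of_real (pderiv f)) z = 0" and zi: "z \<notin> \<real>"
  have f0: "f \<noteq> 0" using assms(2) by auto
  have deg: "degree f \<noteq> 0" using assms(2) by (simp add: pderiv_eq_0_iff)
  obtain \<rho> where \<rho>: "f = smult (lead_coeff f) (\<Prod>j<degree f. [:- \<rho> j, 1:])"
    using real_rooted_decompose[OF assms(1) f0] .
  define c n where "c = (of_real (lead_coeff f) :: complex)" and "n = degree f"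
  have F: "map_poly of_real f = smult c (\<Prod>j<n. [:- complex_of_real (\<rho> j), 1:])"
    by (subst \<rho>) (simp add: map_poly_smult map_poly_of_real_prod map_poly_pCons c_def n_def)
  have c0: "c \<noteq> 0" using f0 by (simp add: c_def)
  have nz: "z - complex_of_real (\<rho> j) \<noteq> 0" for j using zi by auto
  have "poly (map_poly of_real (pderiv f)) z
      = c * (\<Sum>j<n. \<Prod>i\<in>{..<n} - {j}. z - complex_of_real (\<rho> i))"
    unfolding map_poly_of_real_pderiv F
    by (simp add: pderiv_smult pderiv_prod poly_sum poly_prod pderiv_pCons)
  also have "(\<Sum>j<n. \<Prod>i\<in>{..<n} - {j}. z - complex_of_real (\<rho> i))
     = (\<Sum>j<n. (\<Prod>i<n. z - complex_of_real (\<rho> i)) * inverse (z - complex_of_real (\<rho> j)))"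
    by (intro sum.cong refl) (use nz in \<open>auto simp: prod.remove field_simps\<close>)
  finally have "c * (\<Prod>i<n. z - complex_of_real (\<rho> i)) * (\<Sum>j<n. inverse (z - complex_of_real (\<rho> j))) = 0"
    using z0 by (simp add: sum_distrib_left mult.assoc)
  then have "(\<Sum>j<n. inverse (z - complex_of_real (\<rho> j))) = 0"
    using c0 nz by auto
  then have "Im (\<Sum>j<n. inverse (z - complex_of_real (\<rho> j))) = 0" by simp
  then have "(\<Sum>j<n. - Im z / ((Re z - \<rho> j)\<^sup>2 + (Im z)\<^sup>2)) = 0"
    by simp
  then have "Im z * (\<Sum>j<n. 1 / ((Re z - \<rho> j)\<^sup>2 + (Im z)\<^sup>2)) = 0"
    by (simp add: sum_distrib_left sum_negf)
  moreover have im: "Im z \<noteq> 0" using zi by (auto simp: complex_is_Real_iff)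
  moreover have "(\<Sum>j<n. 1 / ((Re z - \<rho> j)\<^sup>2 + (Im z)\<^sup>2)) > 0"
    by (rule sum_pos) (use deg im in \<open>auto simp: n_def intro!: add_nonneg_pos\<close>)
  ultimately show False by simp
qed

text \<open>
  The quantity \<open>D(g) = g\<^sub>1\<^sup>2 - 2 g\<^sub>0 g\<^sub>2\<close> behaves well under multiplication by a linear factor:
  \<open>D((a + b X) g) = a\<^sup>2 D(g) + b\<^sup>2 g\<^sub>0\<^sup>2\<close>. By induction it is nonnegative for products of real
  linear factors, and it vanishes only if \<open>g\<^sub>1 = 0\<close>.
\<close>
lemma real_rooted_coeff_newton:
  assumes "real_rooted f" "coeff f 1 \<noteq> 0"
  shows "2 * coeff f 0 * coeff f 2 < (coeff f 1)\<^sup>2"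
proof -
  define P where "P g \<longleftrightarrow> 2 * coeff g 0 * coeff g 2 \<le> (coeff g 1)\<^sup>2 \<and>
      (coeff g 1 \<noteq> 0 \<longrightarrow> 2 * coeff g 0 * coeff g 2 < (coeff g 1)\<^sup>2)" for g :: "real poly"
  have step: "P ([:a, b:] * g)" if "P g" for a b g
  proof -
    let ?D = "(coeff g 1)\<^sup>2 - 2 * coeff g 0 * coeff g 2"
    have D: "?D \<ge> 0" "coeff g 1 \<noteq> 0 \<Longrightarrow> ?D > 0" using that by (auto simp: P_def)
    have c: "coeff ([:a, b:] * g) 0 = a * coeff g 0"
        "coeff ([:a, b:] * g) 1 = a * coeff g 1 + b * coeff g 0"
        "coeff ([:a, b:] * g) 2 = a * coeff g 2 + b * coeff g 1"
      by (auto simp: coeff_pCons numeral_2_eq_2)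
    have eq: "(coeff ([:a, b:] * g) 1)\<^sup>2 - 2 * coeff ([:a, b:] * g) 0 * coeff ([:a, b:] * g) 2
        = a\<^sup>2 * ?D + b\<^sup>2 * (coeff g 0)\<^sup>2"
      unfolding c by (simp add: power2_eq_square algebra_simps)
    have ge: "a\<^sup>2 * ?D + b\<^sup>2 * (coeff g 0)\<^sup>2 \<ge> 0" using D by simp
    have "a\<^sup>2 * ?D + b\<^sup>2 * (coeff g 0)\<^sup>2 > 0" if "coeff ([:a, b:] * g) 1 \<noteq> 0"
    proof (cases "b * coeff g 0 = 0")
      case True
      then have "a \<noteq> 0" "coeff g 1 \<noteq> 0" using that c by auto
      then show ?thesis using D by (intro add_pos_nonneg) auto
    next
      case False
      then show ?thesis using D by (intro add_nonneg_pos) auto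
    qed
    then show ?thesis using ge eq by (auto simp: P_def)
  qed
  have prod: "P (\<Prod>j<n. [:- \<rho> j, 1:])" for \<rho> and n :: nat
  proof (induction n)
    case 0 show ?case by (simp add: P_def)
  next
    case (Suc n)
    then show ?case using step[of "\<Prod>j<n. [:- \<rho> j, 1:]" "- \<rho> n" 1] by (simp add: mult.commute)
  qed
  have "f \<noteq> 0" using assms by auto
  then obtain \<rho> where \<rho>: "f = smult (lead_coeff f) (\<Prod>j<degree f. [:- \<rho> j, 1:])"
    using real_rooted_decompose[OF assms(1)] by blast
  have "P f"
    using step[OF prod, of "lead_coeff f" 0 \<rho> "degree f"] by (subst \<rho>) simp
  then show ?thesis using assms by (simp add: P_def)
qed

lemma real_rooted_prod_linear:
  "finite I \<Longrightarrow> real_rooted (\<Prod>i\<in>I. [:1, f i:])"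
  unfolding real_rooted_def
proof (intro allI impI)
  fix z :: complex
  assume I: "finite I" and "poly (map_poly of_real (\<Prod>i\<in>I. [:1, f i:])) z = 0"
  then obtain i where i: "1 + z * complex_of_real (f i) = 0"
    by (auto simp: map_poly_of_real_prod poly_prod map_poly_pCons)
  then have "f i \<noteq> 0" by auto
  then have "z = of_real (- 1 / f i)" using i by (auto simp: field_simps add_eq_0_iff)
  then show "z \<in> \<real>" by (metis Reals_of_real)
qed

text \<open>
  The coefficients \<open>l, l+1, l+2\<close> of \<open>\<Prod>(1 + f i X)\<close> become, up to factorials, the coefficients
  \<open>0, 1, 2\<close> of its \<open>l\<close>-th derivative, which is again real-rooted. The strict form is what excludes
  a sign change inside the cone.
\<close>
lemma esym_newton:
  fixes f :: "'i \<Rightarrow> real"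
  assumes I: "finite I" and nz: "esym I (Suc l) f \<noteq> 0"
    and pos: "esym I l f \<ge> 0" "esym I (Suc (Suc l)) f \<ge> 0"
  shows "esym I l f * esym I (Suc (Suc l)) f < (esym I (Suc l) f)\<^sup>2"
proof -
  let ?g = "\<Prod>i\<in>I. [:1, f i:]"
  have rr: "real_rooted ((pderiv ^^ m) ?g) \<or> (pderiv ^^ m) ?g = 0" for m
  proof (induction m)
    case 0
    show ?case using real_rooted_prod_linear[OF I] by auto
  next
    case (Suc m)
    then show ?case using real_rooted_pderiv by fastforce
  qed
  define h where "h = (pderiv ^^ l) ?g"
  have p2: "pochhammer 2 l = (fact l * (real l + 1) :: real)"
    by (induction l) (auto simp: pochhammer_Suc algebra_simps)
  have p3: "pochhammer 3 l = (fact l * (real l + 1) * (real l + 2) / 2 :: real)"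
    by (induction l) (auto simp: pochhammer_Suc algebra_simps)
  define a where "a = (fact l :: real)"
  have a: "a > 0" by (simp add: a_def)
  have c0: "coeff h 0 = a * esym I l f"
    by (simp add: h_def coeff_higher_pderiv coeff_prod_linear[OF I] pochhammer_fact a_def)
  have c1: "coeff h 1 = a * (real l + 1) * esym I (Suc l) f"
    by (simp add: h_def coeff_higher_pderiv coeff_prod_linear[OF I] a_def p2)
  have c2: "coeff h 2 = a * (real l + 1) * (real l + 2) / 2 * esym I (Suc (Suc l)) f"
    by (simp add: h_def coeff_higher_pderiv coeff_prod_linear[OF I] a_def p3)
  have "coeff h 1 \<noteq> 0" using c1 nz a by simp
  then have "2 * coeff h 0 * coeff h 2 < (coeff h 1)\<^sup>2"
    using real_rooted_coeff_newton rr[of l] by (auto simp: h_def)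
  then have "(a\<^sup>2 * (real l + 1)) * ((real l + 2) * (esym I l f * esym I (Suc (Suc l)) f))
      < (a\<^sup>2 * (real l + 1)) * ((real l + 1) * (esym I (Suc l) f)\<^sup>2)"
    unfolding c0 c1 c2 by (simp add: power2_eq_square algebra_simps)
  then have "(real l + 2) * (esym I l f * esym I (Suc (Suc l)) f)
      < (real l + 1) * (esym I (Suc l) f)\<^sup>2"
    using a by (subst (asm) mult_less_cancel_left_pos) auto
  also have "\<dots> \<le> (real l + 2) * (esym I (Suc l) f)\<^sup>2"
    by (intro mult_right_mono) auto
  finally show ?thesis by (simp add: mult_less_cancel_left_pos)
qed

lemma esym_remove:
  assumes "finite I" "i \<in> I"
  shows "esym I (Suc l) f = esym (I - {i}) (Suc l) f + f i * esym (I - {i}) l f"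
  using esym_insert[of "I - {i}" i l f] assms by (simp add: insert_absorb)

text \<open>
  The partial derivatives of \<open>\<sigma>_1, ..., \<sigma>_k\<close> are nonnegative on \<open>\<Gamma>_k\<close>. With \<open>s l = \<sigma>_l(\<lambda>|i)\<close>, if
  \<open>s (m+1)\<close> were the first negative one, then \<open>\<sigma>_(m+1) \<ge> 0\<close> and \<open>\<sigma>_(m+2) \<ge> 0\<close> would force
  \<open>\<lambda>\<^sub>i > 0\<close> and \<open>s m * s (m+2) \<ge> (s (m+1))\<^sup>2\<close>, against Newton's inequality.
\<close>
lemma esym_remove_nonneg:
  fixes f :: "'i \<Rightarrow> real"
  assumes I: "finite I" "i \<in> I" and \<Gamma>: "\<And>l. l \<le> k \<Longrightarrow> esym I l f \<ge> 0"
  shows "l < k \<Longrightarrow> esym (I - {i}) l f \<ge> 0"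
proof (induction l)
  case 0
  show ?case using I by (simp add: esym_0)
next
  case (Suc m)
  define s where "s l = esym (I - {i}) l f" for l
  have E: "s (Suc l) + f i * s l \<ge> 0" if "l < k" for l
    using \<Gamma>[of "Suc l"] that by (simp add: esym_remove[OF I] s_def)
  have s0: "s m \<ge> 0" using Suc by (simp add: s_def)
  have "s (Suc m) \<ge> 0"
  proof (rule ccontr)
    assume "\<not> ?thesis"
    then have neg: "s (Suc m) < 0" by simp
    have "f i * s m > 0" using E[of m] neg Suc.prems by simp
    then have f: "f i > 0" using s0 by (simp add: zero_less_mult_iff)
    have ge: "s (Suc (Suc m)) \<ge> f i * (- s (Suc m))"
      using E[of "Suc m"] Suc.prems by simp
    moreover have "f i * (- s (Suc m)) \<ge> 0" using f neg by (intro mult_nonneg_nonneg) auto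
    ultimately have "s (Suc (Suc m)) \<ge> 0" by linarith
    then have "s m * s (Suc (Suc m)) < (s (Suc m))\<^sup>2"
      using esym_newton[of "I - {i}" m f] I neg s0 by (auto simp: s_def)
    moreover have "(- s (Suc m)) * (- s (Suc m)) \<le> (f i * s m) * (- s (Suc m))"
      by (intro mult_right_mono) (use E[of m] Suc.prems neg in auto)
    moreover have "s m * (f i * (- s (Suc m))) \<le> s m * s (Suc (Suc m))"
      by (rule mult_left_mono[OF ge s0])
    ultimately show False by (simp add: power2_eq_square algebra_simps)
  qed
  then show ?case by (simp add: s_def)
qed

text \<open>
  Coordinates are raised one at a time. The partial derivative in direction \<open>i\<close> is independent of
  the \<open>i\<close>-th coordinate and nonnegative, so each step stays in the cone.
\<close>
lemma esym_mono:
  fixes f g :: "'i \<Rightarrow> real"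
  assumes I: "finite I" and \<Gamma>: "\<And>l. l \<le> k \<Longrightarrow> esym I l f \<ge> 0"
    and le: "\<And>i. i \<in> I \<Longrightarrow> f i \<le> g i" and l: "l \<le> k"
  shows "esym I l f \<le> esym I l g"
proof -
  define h where "h J = (\<lambda>i. if i \<in> J then g i else f i)" for J
  have "J \<subseteq> I \<Longrightarrow> \<forall>l\<le>k. esym I l f \<le> esym I l (h J)" if "finite J" for J
    using that
  proof (induction J rule: finite_induct)
    case empty
    show ?case by (simp add: h_def)
  next
    case (insert i J)
    then have IH: "\<forall>l\<le>k. esym I l f \<le> esym I l (h J)" and i: "i \<in> I" by auto
    have \<Gamma>': "esym I l (h J) \<ge> 0" if "l \<le> k" for l
      using IH \<Gamma>[OF that] that by force
    have "esym I l (h J) \<le> esym I l (h (insert i J))" if l: "l \<le> k" for l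
    proof (cases l)
      case 0
      then show ?thesis using I by (simp add: esym_0)
    next
      case (Suc m)
      have "h J i \<le> h (insert i J) i" using le[OF i] by (simp add: h_def)
      then have "h J i * esym (I - {i}) m (h J) \<le> h (insert i J) i * esym (I - {i}) m (h J)"
        using esym_remove_nonneg[OF I i \<Gamma>', where k = k and l = m] Suc l by (intro mult_right_mono) auto
      moreover have "esym (I - {i}) m (h (insert i J)) = esym (I - {i}) m (h J)" for m
        by (rule esym_cong) (auto simp: h_def)
      ultimately show ?thesis by (simp add: Suc esym_remove[OF I i])
    qed
    then show ?case using IH by force
  qed
  from this[OF I] l have "esym I l f \<le> esym I l (h I)" by auto
  also have "esym I l (h I) = esym I l g" by (rule esym_cong) (simp add: h_def)
  finally show ?thesis .
qed

text \<open>
  The tuple \<open>(a, b, ..., b)\<close> is the spectrum of the Hessian of a radial function.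
\<close>
lemma esym_one_exceptional:
  fixes a b :: "'a::comm_ring_1"
  assumes I: "finite I" "j \<in> I"
  shows "esym I (Suc m) (\<lambda>i. if i = j then a else b) =
    of_nat (card I - 1 choose Suc m) * b ^ Suc m + of_nat (card I - 1 choose m) * a * b ^ m"
proof -
  have "esym (I - {j}) l (\<lambda>i. if i = j then a else b) = of_nat (card I - 1 choose l) * b ^ l" for l
  proof -
    have "esym (I - {j}) l (\<lambda>i. if i = j then a else b) = esym (I - {j}) l (\<lambda>_. b)"
      by (rule esym_cong) auto
    then show ?thesis using I by (simp add: esym_const)
  qed
  then show ?thesis using esym_remove[OF I, of m "\<lambda>i. if i = j then a else b"] by (simp add: mult_ac)
qed

lemma esym_le_one_exceptional:
  fixes f :: "'i \<Rightarrow> real"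
  assumes I: "finite I" "j \<in> I" and \<Gamma>: "\<And>l. l \<le> Suc m \<Longrightarrow> esym I l f \<ge> 0"
    and b: "\<And>i. i \<in> I \<Longrightarrow> f i \<le> b" and a: "f j \<le> a"
  shows "esym I (Suc m) f \<le>
    real (card I - 1 choose Suc m) * b ^ Suc m + real (card I - 1 choose m) * a * b ^ m"
proof -
  have "esym I (Suc m) f \<le> esym I (Suc m) (\<lambda>i. if i = j then a else b)"
    using assms by (intro esym_mono[where k = "Suc m"]) auto
  then show ?thesis using esym_one_exceptional[OF I, of m a b] by simp
qed

section \<open>Eigenvalues of real matrices\<close>

lemma poly_charpoly:
  fixes A :: "'a::comm_ring_1 ^ 'n ^ 'n"
  shows "poly (charpoly A) t = det (mat t - A)"
  unfolding charpoly_def det_def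
  by (simp add: poly_sum poly_prod mat_def)
     (intro sum.cong refl arg_cong2[of _ _ _ _ "(*)"] prod.cong, auto)

lemma poly_charpoly_complex_mat:
  fixes A :: "real ^ 'n ^ 'n"
  shows "poly (charpoly (complex_mat A)) (of_real t) = of_real (det (mat t - A))"
  unfolding poly_charpoly det_def complex_mat_def
  by (simp add: mat_def)
     (intro sum.cong refl arg_cong2[of _ _ _ _ "(*)"] prod.cong, auto)

lemma mat_mult_vec: "mat t *v x = t *\<^sub>R x" for x :: "real ^ 'n"
  by (simp add: vec_eq_iff matrix_vector_mult_def mat_def if_distrib if_distribR cong: if_cong)

lemma det_eq_0_iff_eigenvector:
  fixes A :: "real ^ 'n ^ 'n"
  shows "det (mat t - A) = 0 \<longleftrightarrow> (\<exists>x. x \<noteq> 0 \<and> A *v x = t *\<^sub>R x)"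
proof -
  have "det (mat t - A) = 0 \<longleftrightarrow> \<not> invertible (mat t - A)"
    by (simp add: invertible_det_nz)
  also have "\<dots> \<longleftrightarrow> (\<exists>x. x \<noteq> 0 \<and> (mat t - A) *v x = 0)"
    using invertible_left_inverse matrix_left_invertible_ker by blast
  finally show ?thesis
    by (simp add: matrix_vector_mult_diff_rdistrib mat_mult_vec eq_commute[of "t *\<^sub>R _"])
qed

lemma esym_of_real: "esym I l (\<lambda>i. of_real (f i)) = of_real (esym I l f)"
  by (simp add: esym_def)

text \<open>
  Monic polynomials with roots \<open>f i\<close> are the reflections of \<open>\<Prod>(1 - f i X)\<close>, whose coefficients are
  the symmetric polynomials up to sign.
\<close>
lemma esym_eq_if_prod_eq:
  fixes f g :: "'i \<Rightarrow> complex"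
  assumes "finite I" "(\<Prod>i\<in>I. [:- f i, 1:]) = (\<Prod>i\<in>I. [:- g i, 1:])"
  shows "esym I l f = esym I l g"
proof -
  have r: "(\<Prod>i\<in>I. [:1, - f i:]) = reflect_poly (\<Prod>i\<in>I. [:- f i, 1:])" for f :: "'i \<Rightarrow> complex"
    by (simp add: reflect_poly_prod) (simp add: reflect_poly_def)
  have "esym I l (\<lambda>i. - f i) = esym I l (\<lambda>i. - g i)"
    using assms by (simp flip: coeff_prod_linear add: r)
  then show ?thesis by (simp add: esym_uminus)
qed

text \<open>
  The tuple of eigenvalues is only determined up to order, so it cannot be identified with \<open>\<nu>\<close>;
  but its symmetric polynomials can. It suffices to know the characteristic polynomial on the real
  line.
\<close>
lemma eigvals_real_if_det_factors:
  fixes A :: "real ^ 'n ^ 'n" and \<nu> :: "'n \<Rightarrow> real"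
  assumes "\<And>t. det (mat t - A) = (\<Prod>i\<in>UNIV. t - \<nu> i)"
  obtains \<mu> where "eigvals A = (\<chi> i. complex_of_real (\<mu> $ i))"
    "\<And>l. elem_sym l \<mu> = esym UNIV l \<nu>"
proof -
  let ?q = "\<Prod>i\<in>(UNIV::'n set). [:- complex_of_real (\<nu> i), 1:]"
  have "poly (charpoly (complex_mat A) - ?q) (of_real t) = 0" for t
    by (simp add: poly_charpoly_complex_mat assms poly_prod)
  then have "range complex_of_real \<subseteq> {z. poly (charpoly (complex_mat A) - ?q) z = 0}"
    by auto
  moreover have "infinite (range complex_of_real)"
    using infinite_UNIV_char_0[where 'a = real] by (simp add: finite_image_iff inj_on_def)
  ultimately have "charpoly (complex_mat A) - ?q = 0"
    using poly_roots_finite finite_subset by blast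
  then have eq: "(\<Prod>i\<in>UNIV. [:- (eigvals A $ i), 1:]) = ?q"
    by (simp add: charpoly_eigvals)
  define \<mu> :: "real ^ 'n" where "\<mu> = (\<chi> i. Re (eigvals A $ i))"
  have "eigvals A $ j = of_real (\<mu> $ j)" for j
  proof -
    have "poly ?q (eigvals A $ j) = 0"
      unfolding eq[symmetric] by (auto simp: poly_prod)
    then show ?thesis by (auto simp: poly_prod \<mu>_def)
  qed
  then have \<mu>: "eigvals A = (\<chi> i. complex_of_real (\<mu> $ i))"
    by (simp add: vec_eq_iff)
  have "elem_sym l \<mu> = esym UNIV l \<nu>" for l
  proof -
    have "esym UNIV l (\<lambda>i. complex_of_real (\<mu> $ i)) = esym UNIV l (\<lambda>i. complex_of_real (\<nu> i))"
      by (rule esym_eq_if_prod_eq) (use eq \<mu> in auto)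
    then show ?thesis by (simp add: esym_of_real elem_sym_esym)
  qed
  with \<mu> show ?thesis using that by blast
qed

lemma elem_sym_of_real: "elem_sym l (\<chi> i. of_real (\<mu> $ i)) = of_real (elem_sym l \<mu>)"
  by (simp add: elem_sym_def)

lemma elem_sym_eigvals_zero:
  "k > 0 \<Longrightarrow> elem_sym k (eigvals (0 :: real ^ 'n ^ 'n)) = 0"
proof -
  assume k: "k > 0"
  have "det (mat t - 0 :: real ^ 'n ^ 'n) = (\<Prod>i\<in>(UNIV::'n set). t - 0)" for t
    by (subst det_diagonal) (auto simp: mat_def)
  then obtain \<mu> :: "real ^ 'n" where "eigvals (0 :: real ^ 'n ^ 'n) = (\<chi> i. complex_of_real (\<mu> $ i))"
    "\<And>l. elem_sym l \<mu> = esym UNIV l (\<lambda>i::'n. 0)"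
    using eigvals_real_if_det_factors[of "0 :: real ^ 'n ^ 'n" "\<lambda>_. 0"] by blast
  then show ?thesis using k by (simp add: elem_sym_of_real esym_const power_0_left)
qed

text \<open>
  After reordering, the tuple of eigenvalues lies below \<open>(a, b, ..., b)\<close> in every coordinate, and
  \<open>\<sigma>_k\<close> is monotone on the cone.
\<close>
lemma elem_sym_eigvals_le:
  fixes A :: "real ^ 'n ^ 'n"
  assumes "eigvals_in A (Gamma_cone (Suc m))"
    and b: "\<And>t x. x \<noteq> 0 \<Longrightarrow> A *v x = t *\<^sub>R x \<Longrightarrow> t \<le> b"
    and a: "A *v y = s *\<^sub>R y" "y \<noteq> 0" "s \<le> a"
  shows "Re (elem_sym (Suc m) (eigvals A)) \<le>
    real (CARD('n) - 1 choose Suc m) * b ^ Suc m + real (CARD('n) - 1 choose m) * a * b ^ m"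
proof -
  obtain \<mu> where \<mu>: "\<mu> \<in> Gamma_cone (Suc m)" "eigvals A = (\<chi> i. complex_of_real (\<mu> $ i))"
    using assms(1) by (auto simp: eigvals_in_def)
  have det: "det (mat t - A) = (\<Prod>i\<in>UNIV. t - \<mu> $ i)" for t
  proof -
    have "complex_of_real (det (mat t - A)) = of_real (\<Prod>i\<in>UNIV. t - \<mu> $ i)"
      by (simp flip: poly_charpoly_complex_mat add: charpoly_eigvals \<mu>(2) poly_prod)
    then show ?thesis by (simp only: of_real_eq_iff)
  qed
  have "\<mu> $ i \<le> b" for i
  proof -
    have "det (mat (\<mu> $ i) - A) = 0" by (auto simp: det)
    then show ?thesis using b by (auto simp: det_eq_0_iff_eigenvector)
  qed
  moreover have "\<exists>j. \<mu> $ j = s"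
  proof -
    have "det (mat s - A) = 0" using a by (auto simp: det_eq_0_iff_eigenvector)
    then show ?thesis by (auto simp: det)
  qed
  moreover have "esym UNIV l (($) \<mu>) \<ge> 0" if "l \<le> Suc m" for l
    using \<mu>(1) that by (cases "l = 0") (auto simp: Gamma_cone_def elem_sym_esym esym_0)
  ultimately show ?thesis
    using esym_le_one_exceptional[of UNIV _ m "($) \<mu>" b a] a
    by (auto simp: \<mu>(2) elem_sym_of_real) (auto simp: elem_sym_esym)
qed

text \<open>
  After a rotation taking \<open>x\<close> to a multiple of a coordinate vector, the matrix \<open>s I + c x x\<^sup>T\<close> is
  diagonal.
\<close>
lemma det_scalar_plus_rank_one:
  fixes M :: "real ^ 'n ^ 'n" and j :: 'n
  assumes M: "\<And>h :: real ^ 'n. M *v h = s *\<^sub>R h + (c * (x \<bullet> h)) *\<^sub>R x"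
  shows "det M = (\<Prod>i\<in>UNIV. if i = j then s + c * (norm x)\<^sup>2 else s)"
proof -
  have "norm x = norm (norm x *\<^sub>R axis j (1::real) :: real ^ 'n)" by (simp add: norm_axis_1)
  then obtain f where f: "orthogonal_transformation f" "f x = norm x *\<^sub>R axis j (1::real)"
    by (rule orthogonal_transformation_exists)
  define Q where "Q = matrix f"
  have Q: "orthogonal_matrix Q" and Qx: "Q *v x = norm x *\<^sub>R axis j (1::real)"
    using f by (auto simp: Q_def orthogonal_transformation_matrix)
  have QQ: "Q ** transpose Q = mat 1" using Q by (simp add: orthogonal_matrix_def)
  define D :: "real ^ 'n ^ 'n"
    where "D = (\<chi> i l. if i = l then (if i = j then s + c * (norm x)\<^sup>2 else s) else 0)"
  have "Q ** M ** transpose Q = D"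
    unfolding matrix_eq
  proof
    fix y :: "real ^ 'n"
    have "Q ** M ** transpose Q *v y = Q *v (M *v (transpose Q *v y))"
      by (simp only: matrix_vector_mul_assoc matrix_mul_assoc)
    also have "\<dots> = s *\<^sub>R ((Q ** transpose Q) *v y) + (c * (x \<bullet> (transpose Q *v y))) *\<^sub>R (Q *v x)"
      by (simp only: M matrix_vector_right_distrib matrix_vector_mult_scaleR)
         (simp only: matrix_vector_mul_assoc)
    also have "x \<bullet> (transpose Q *v y) = (Q *v x) \<bullet> y"
      by (metis dot_lmul_matrix inner_commute transpose_matrix_vector)
    also have "s *\<^sub>R ((Q ** transpose Q) *v y) + (c * ((Q *v x) \<bullet> y)) *\<^sub>R (Q *v x) = D *v y"
    proof -
      have "(D *v y) $ i = (if i = j then s + c * (norm x)\<^sup>2 else s) * y $ i" for i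
        by (simp add: matrix_vector_mult_def D_def if_distrib[of "\<lambda>u. u * _"] cong: if_cong)
      moreover have "axis j (1::real) \<bullet> y = y $ j" by (simp add: inner_axis')
      ultimately show ?thesis
        unfolding QQ Qx by (auto simp: vec_eq_iff axis_def power2_eq_square algebra_simps)
    qed
    finally show "Q ** M ** transpose Q *v y = D *v y" .
  qed
  moreover have "det (Q ** M ** transpose Q) = det M"
    using arg_cong[OF QQ, of det] by (simp add: det_mul)
  moreover have "det D = (\<Prod>i\<in>UNIV. if i = j then s + c * (norm x)\<^sup>2 else s)"
    by (subst det_diagonal) (auto simp: D_def)
  ultimately show ?thesis by simp
qed

lemma eigvals_scalar_plus_rank_one:
  fixes A :: "real ^ 'n ^ 'n"
  assumes A: "\<And>h :: real ^ 'n. A *v h = b *\<^sub>R h + (c * (x \<bullet> h)) *\<^sub>R x"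
  obtains \<mu> where "eigvals A = (\<chi> i. complex_of_real (\<mu> $ i))"
    "\<And>l. elem_sym (Suc l) \<mu> = real (CARD('n) - 1 choose Suc l) * b ^ Suc l
       + real (CARD('n) - 1 choose l) * (b + c * (norm x)\<^sup>2) * b ^ l"
proof -
  obtain j :: 'n where True by blast
  define \<nu> where "\<nu> = (\<lambda>i. if i = j then b + c * (norm x)\<^sup>2 else b)"
  have "det (mat t - A) = (\<Prod>i\<in>UNIV. t - \<nu> i)" for t
  proof -
    have "(mat t - A) *v h = (t - b) *\<^sub>R h + ((- c) * (x \<bullet> h)) *\<^sub>R x" for h :: "real ^ 'n"
      by (simp add: matrix_vector_mult_diff_rdistrib mat_mult_vec A algebra_simps)
    from det_scalar_plus_rank_one[OF this, of j] show ?thesis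
      by (auto simp: \<nu>_def intro!: prod.cong)
  qed
  from eigvals_real_if_det_factors[OF this] obtain \<mu>
    where "eigvals A = (\<chi> i. complex_of_real (\<mu> $ i))" "\<And>l. elem_sym l \<mu> = esym UNIV l \<nu>" by blast
  then show ?thesis
    using that[of \<mu>] esym_one_exceptional[of UNIV j _ "b + c * (norm x)\<^sup>2" b] by (simp add: \<nu>_def)
qed

section \<open>Second-order calculus\<close>

lemma has_derivative_norm_powr:
  fixes x :: "'a::real_inner"
  assumes "x \<noteq> 0"
  shows "((\<lambda>x. norm x powr q) has_derivative (\<lambda>h. q * norm x powr (q - 2) * (x \<bullet> h))) (at x)"
proof -
  have n: "norm x > 0" using assms by simp
  have e: "norm x powr (q - 1) = norm x powr (q - 2) * norm x"
    using n powr_add[of "norm x" "q - 2" 1] by simp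
  have "((\<lambda>t. t powr q) has_derivative (\<lambda>t. q * norm x powr (q - 1) * t)) (at (norm x))"
    using has_real_derivative_powr[OF n, of q] by (simp add: has_field_derivative_def)
  from has_derivative_compose[OF has_derivative_norm[OF assms] this]
  have "((\<lambda>x. norm x powr q) has_derivative (\<lambda>h. q * norm x powr (q - 1) * (h \<bullet> sgn x))) (at x)" .
  moreover have "q * norm x powr (q - 1) * (h \<bullet> sgn x) = q * norm x powr (q - 2) * (x \<bullet> h)" for h
    using n by (simp add: e sgn_div_norm inner_commute field_simps)
  ultimately show ?thesis by simp
qed

lemma has_derivative_norm_powr_scaleR:
  fixes x :: "'a::real_inner"
  assumes "x \<noteq> 0"
  shows "((\<lambda>x. norm x powr q *\<^sub>R x) has_derivative
    (\<lambda>h. norm x powr q *\<^sub>R h + (q * norm x powr (q - 2) * (x \<bullet> h)) *\<^sub>R x)) (at x)"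
  using has_derivative_scaleR[OF has_derivative_norm_powr[OF assms] has_derivative_ident] .

text \<open>
  Symmetry of the second derivative, for a gradient that is differentiable at one point only. Both
  \<open>H h \<bullet> k\<close> and \<open>H k \<bullet> h\<close> are limits of the same second difference quotient of \<open>u\<close>: the mean value
  theorem in one of the two directions turns it into a difference of gradients.
\<close>
lemma gradient_derivative_symmetric:
  fixes u :: "'a::real_inner \<Rightarrow> real"
  assumes u: "\<And>z. (u has_derivative (\<lambda>h. g z \<bullet> h)) (at z)"
    and g: "(g has_derivative H) (at x)"
  shows "H h \<bullet> k = H k \<bullet> h"
proof -
  interpret H: bounded_linear H using g by (rule has_derivative_bounded_linear)
  define C where "C h k = norm h * (2 * norm h + norm k)" for h k :: 'a
  \<comment> \<open>The bound \<open>C h k\<close> collects the errors of the linear approximation of \<open>g\<close> at the two points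
    \<open>x + s t h + t k\<close> and \<open>x + s t h\<close>, each at distance at most \<open>t (|h| + |k|)\<close> from \<open>x\<close>.\<close>
  have quot: "\<exists>d>0. \<forall>t. 0 < t \<and> t < d \<longrightarrow>
      \<bar>u (x + t *\<^sub>R h + t *\<^sub>R k) - u (x + t *\<^sub>R h) - (u (x + t *\<^sub>R k) - u x) - t\<^sup>2 * (H k \<bullet> h)\<bar> \<le> e * t\<^sup>2 * C h k"
    if e: "e > 0" for e and h k :: 'a
  proof -
    obtain d where d: "d > 0" "\<And>z. norm (z - x) < d \<Longrightarrow> norm (g z - g x - H (z - x)) \<le> e * norm (z - x)"
      using g e unfolding has_derivative_at_alt by blast
    define d' where "d' = d / (norm h + norm k + 1)"
    have "d' > 0" using d by (simp add: d'_def add_nonneg_pos)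
    moreover have "\<bar>u (x + t *\<^sub>R h + t *\<^sub>R k) - u (x + t *\<^sub>R h) - (u (x + t *\<^sub>R k) - u x) - t\<^sup>2 * (H k \<bullet> h)\<bar>
        \<le> e * t\<^sup>2 * C h k" if t: "0 < t" "t < d'" for t
    proof -
      define f where "f s = u (x + s *\<^sub>R (t *\<^sub>R h) + t *\<^sub>R k) - u (x + s *\<^sub>R (t *\<^sub>R h))" for s
      have der: "(f has_real_derivative
          t * ((g (x + s *\<^sub>R (t *\<^sub>R h) + t *\<^sub>R k) - g (x + s *\<^sub>R (t *\<^sub>R h))) \<bullet> h)) (at s)" for s
      proof -
        have 1: "((\<lambda>s. x + s *\<^sub>R (t *\<^sub>R h) + y) has_derivative (\<lambda>s. s *\<^sub>R (t *\<^sub>R h))) (at s)" for y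
          by (auto intro!: derivative_eq_intros)
        have "((\<lambda>s. x + s *\<^sub>R (t *\<^sub>R h)) has_derivative (\<lambda>s. s *\<^sub>R (t *\<^sub>R h))) (at s)"
          by (auto intro!: derivative_eq_intros)
        from has_derivative_diff[OF has_derivative_compose[OF 1 u] has_derivative_compose[OF this u]]
        show ?thesis
          unfolding f_def has_field_derivative_def
          by (rule has_derivative_eq_rhs) (auto simp: inner_diff_left algebra_simps)
      qed
      obtain s where s: "0 < s" "s < 1"
        "f 1 - f 0 = t * ((g (x + s *\<^sub>R (t *\<^sub>R h) + t *\<^sub>R k) - g (x + s *\<^sub>R (t *\<^sub>R h))) \<bullet> h)"
        using MVT2[of 0 1 f, OF _ der] by auto
      define a b where "a = s *\<^sub>R (t *\<^sub>R h) + t *\<^sub>R k" and "b = s *\<^sub>R (t *\<^sub>R h)"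
      have nb: "norm b \<le> t * norm h"
        using s t by (simp add: b_def mult_le_cancel_right1 mult_left_le_one_le)
      have na: "norm a \<le> t * (norm h + norm k)"
        using norm_triangle_ineq[of "s *\<^sub>R (t *\<^sub>R h)" "t *\<^sub>R k"] nb t
        by (simp add: a_def b_def algebra_simps)
      have td: "t * (norm h + norm k + 1) < d"
        using t by (simp add: d'_def pos_less_divide_eq add_nonneg_pos)
      have "t * (norm h + norm k) < d"
        using td t by (simp add: algebra_simps)
      then have a: "norm (g (x + a) - g x - H a) \<le> e * norm a"
        using d(2)[of "x + a"] na by simp
      have "t * norm h \<le> t * (norm h + norm k)" using t by simp
      then have b: "norm (g (x + b) - g x - H b) \<le> e * norm b"
        using d(2)[of "x + b"] nb \<open>t * (norm h + norm k) < d\<close> by simp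
      have Hab: "H a - H b = t *\<^sub>R H k" by (simp add: a_def b_def H.add H.scaleR)
      have "f 1 - f 0 - t\<^sup>2 * (H k \<bullet> h) = t * (((g (x + a) - g (x + b)) - t *\<^sub>R H k) \<bullet> h)"
        using s(3) by (simp add: a_def b_def add.assoc inner_diff_left power2_eq_square algebra_simps)
      also have "(g (x + a) - g (x + b)) - t *\<^sub>R H k = (g (x + a) - g x - H a) - (g (x + b) - g x - H b)"
        unfolding Hab[symmetric] by simp
      finally have "\<bar>f 1 - f 0 - t\<^sup>2 * (H k \<bullet> h)\<bar>
          = t * \<bar>((g (x + a) - g x - H a) - (g (x + b) - g x - H b)) \<bullet> h\<bar>"
        using t by (simp add: abs_mult)
      also have "\<dots> \<le> t * ((e * norm a + e * norm b) * norm h)"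
      proof -
        have "norm ((g (x + a) - g x - H a) - (g (x + b) - g x - H b)) \<le> e * norm a + e * norm b"
          using norm_triangle_ineq4[of "g (x + a) - g x - H a" "g (x + b) - g x - H b"] a b by linarith
        then show ?thesis
          using t by (intro mult_left_mono order.trans[OF Cauchy_Schwarz_ineq2] mult_right_mono) auto
      qed
      also have "\<dots> \<le> t * ((e * (t * (norm h + norm k)) + e * (t * norm h)) * norm h)"
        using t na nb e by (intro mult_left_mono mult_right_mono add_mono) auto
      also have "\<dots> = e * t\<^sup>2 * C h k"
        by (simp add: C_def power2_eq_square algebra_simps)
      finally show ?thesis by (simp add: f_def)
    qed
    ultimately show ?thesis by blast
  qed
  have "\<bar>H h \<bullet> k - H k \<bullet> h\<bar> \<le> e * (C h k + C k h)" if e: "e > 0" for e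
  proof -
    let ?F = "\<lambda>t h k. u (x + t *\<^sub>R h + t *\<^sub>R k) - u (x + t *\<^sub>R h) - (u (x + t *\<^sub>R k) - u x)"
    obtain d1 d2 where d: "d1 > 0" "d2 > 0"
      "\<And>t. 0 < t \<Longrightarrow> t < d1 \<Longrightarrow> \<bar>?F t h k - t\<^sup>2 * (H k \<bullet> h)\<bar> \<le> e * t\<^sup>2 * C h k"
      "\<And>t. 0 < t \<Longrightarrow> t < d2 \<Longrightarrow> \<bar>?F t k h - t\<^sup>2 * (H h \<bullet> k)\<bar> \<le> e * t\<^sup>2 * C k h"
      using quot[OF e, of h k] quot[OF e, of k h] by blast
    define t where "t = min d1 d2 / 2"
    have t: "0 < t" "t < d1" "t < d2" using d(1,2) by (auto simp: t_def)
    have "?F t h k = ?F t k h" by (simp add: add.assoc add.commute[of "t *\<^sub>R h"])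
    then have "\<bar>t\<^sup>2 * (H h \<bullet> k) - t\<^sup>2 * (H k \<bullet> h)\<bar> \<le> e * t\<^sup>2 * C h k + e * t\<^sup>2 * C k h"
      using d(3)[OF t(1,2)] d(4)[OF t(1,3)] by linarith
    then have "t\<^sup>2 * \<bar>H h \<bullet> k - H k \<bullet> h\<bar> \<le> t\<^sup>2 * (e * (C h k + C k h))"
      by (simp add: abs_mult flip: right_diff_distrib) (simp add: algebra_simps)
    then show ?thesis using t by simp
  qed
  note bound = this
  have "\<bar>H h \<bullet> k - H k \<bullet> h\<bar> \<le> 0 * (C h k + C k h)"
  proof (rule tendsto_lowerbound)
    show "((\<lambda>e. e * (C h k + C k h)) \<longlongrightarrow> 0 * (C h k + C k h)) (at_right 0)"
      by (intro tendsto_intros)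
    show "\<forall>\<^sub>F e in at_right 0. \<bar>H h \<bullet> k - H k \<bullet> h\<bar> \<le> e * (C h k + C k h)"
      using bound by (auto simp: eventually_at_right_field intro: exI[of _ 1])
  qed simp
  then show ?thesis by simp
qed

text \<open>
  As \<open>g x = 0\<close>, the mean value theorem gives \<open>w(x + t h) - w x = t (g(x + s h) \<bullet> h)\<close> with
  \<open>g(x + s h) = s H h + o(s)\<close> and \<open>0 < s < t\<close>.
\<close>
lemma second_derivative_at_local_max:
  fixes w :: "'a::real_inner \<Rightarrow> real"
  assumes w: "\<And>z. z \<in> ball x d \<Longrightarrow> (w has_derivative (\<lambda>h. g z \<bullet> h)) (at z)" and d: "d > 0"
    and max: "\<And>z. z \<in> ball x d \<Longrightarrow> w z \<le> w x"
    and g: "(g has_derivative H) (at x)" and g0: "g x = 0"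
  shows "H h \<bullet> h \<le> 0"
proof (cases "h = 0")
  case False
  interpret H: bounded_linear H using g by (rule has_derivative_bounded_linear)
  have le: "H h \<bullet> h \<le> e * (norm h)\<^sup>2" if e: "e > 0" for e
  proof -
    obtain d' where d': "d' > 0" "\<And>z. norm (z - x) < d' \<Longrightarrow> norm (g z - g x - H (z - x)) \<le> e * norm (z - x)"
      using g e unfolding has_derivative_at_alt by blast
    define t where "t = min d d' / (2 * norm h)"
    have t: "t > 0" "t * norm h < d" "t * norm h < d'"
      using d d' False by (auto simp: t_def min_def)
    have small: "norm (s *\<^sub>R h) < d" "norm (s *\<^sub>R h) < d'" if "0 \<le> s" "s \<le> t" for s
    proof -
      have "norm (s *\<^sub>R h) \<le> t * norm h" using that by (simp add: mult_right_mono)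
      then show "norm (s *\<^sub>R h) < d" "norm (s *\<^sub>R h) < d'" using t by linarith+
    qed
    have der: "((\<lambda>s. w (x + s *\<^sub>R h)) has_real_derivative g (x + s *\<^sub>R h) \<bullet> h) (at s)"
      if "0 \<le> s" "s \<le> t" for s
    proof -
      have "((\<lambda>s. x + s *\<^sub>R h) has_derivative (\<lambda>s. s *\<^sub>R h)) (at s)"
        by (auto intro!: derivative_eq_intros)
      moreover have "(w has_derivative (\<lambda>k. g (x + s *\<^sub>R h) \<bullet> k)) (at (x + s *\<^sub>R h))"
        using small[OF that] by (intro w) (simp add: dist_norm)
      ultimately show ?thesis
        unfolding has_field_derivative_def
        by (rule has_derivative_eq_rhs[OF has_derivative_compose]) (auto simp: mult.commute)
    qed
    obtain s where s: "0 < s" "s < t" "w (x + t *\<^sub>R h) - w (x + 0 *\<^sub>R h) = (t - 0) * (g (x + s *\<^sub>R h) \<bullet> h)"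
      using MVT2[OF t(1) der] by blast
    have "w (x + t *\<^sub>R h) \<le> w x" using small[of t] t by (intro max) (simp add: dist_norm)
    then have "t * (g (x + s *\<^sub>R h) \<bullet> h) \<le> 0" using s(3) by simp
    then have "g (x + s *\<^sub>R h) \<bullet> h \<le> 0" using t(1) by (simp add: mult_le_0_iff)
    moreover have "norm (g (x + s *\<^sub>R h) - s *\<^sub>R H h) \<le> e * norm (s *\<^sub>R h)"
      using d'(2)[of "x + s *\<^sub>R h"] small[of s] s g0 by (simp add: H.scaleR)
    then have "\<bar>(g (x + s *\<^sub>R h) - s *\<^sub>R H h) \<bullet> h\<bar> \<le> e * norm (s *\<^sub>R h) * norm h"
      by (intro order.trans[OF Cauchy_Schwarz_ineq2] mult_right_mono) auto
    moreover have "(g (x + s *\<^sub>R h) - s *\<^sub>R H h) \<bullet> h = g (x + s *\<^sub>R h) \<bullet> h - s * (H h \<bullet> h)"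
      by (simp add: inner_diff_left)
    moreover have "e * norm (s *\<^sub>R h) * norm h = s * (e * (norm h)\<^sup>2)"
      using s by (simp add: power2_eq_square)
    ultimately have "s * (H h \<bullet> h) \<le> s * (e * (norm h)\<^sup>2)"
      by linarith
    then show ?thesis using s by simp
  qed
  show ?thesis
  proof (rule ccontr)
    assume "\<not> ?thesis"
    then show False using le[of "(H h \<bullet> h) / (2 * (norm h)\<^sup>2)"] False by (simp add: field_simps)
  qed
qed (use has_derivative_bounded_linear[OF g] in \<open>simp add: linear_simps\<close>)

text \<open>
  The minimum of \<open>(H x \<bullet> x)/(N x \<bullet> x)\<close> is a generalised eigenvalue, and it is at most the value at
  \<open>e\<close>. This is the only piece of spectral theory that the comparison of spectra requires.
\<close>
lemma rayleigh_minimum: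
  fixes H N :: "'a::euclidean_space \<Rightarrow> 'a"
  assumes "linear H" "linear N"
    and H: "\<And>h k. H h \<bullet> k = H k \<bullet> h" and N: "\<And>h k. N h \<bullet> k = N k \<bullet> h"
    and pos: "\<And>h. h \<noteq> 0 \<Longrightarrow> N h \<bullet> h > 0"
    and e: "e \<noteq> 0" "H e \<bullet> e \<le> a * (N e \<bullet> e)"
  obtains x t where "x \<noteq> 0" "t \<le> a" "H x = t *\<^sub>R N x"
proof -
  interpret H: linear H by fact
  interpret N: linear N by fact
  define q where "q x = (H x \<bullet> x) / (N x \<bullet> x)" for x
  have q_scale: "q (c *\<^sub>R x) = q x" if "c \<noteq> 0" for c x
    using that by (simp add: q_def H.scaleR N.scaleR)
  have "N x \<bullet> x \<noteq> 0" if "x \<in> sphere 0 1" for x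
    using pos[of x] that by (metis dist_0_norm less_irrefl mem_sphere norm_zero zero_neq_one)
  then have "continuous_on (sphere 0 1) q"
    unfolding q_def using assms(1,2)
    by (intro continuous_intros linear_continuous_on) (auto simp: linear_conv_bounded_linear)
  moreover have "sphere (0::'a) 1 \<noteq> {}" by simp
  ultimately obtain x where x: "norm x = 1" "\<And>y. norm y = 1 \<Longrightarrow> q x \<le> q y"
    using continuous_attains_inf[of "sphere (0::'a) 1" q] by (auto simp: dist_norm)
  have min: "q x \<le> q y" if "y \<noteq> 0" for y
    using x(2)[of "y /\<^sub>R norm y"] q_scale[of "inverse (norm y)" y] that by simp
  define B where "B h = H h - q x *\<^sub>R N h" for h
  have x0: "x \<noteq> 0" using x by auto
  have B: "B h \<bullet> h \<ge> 0" for h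
  proof (cases "h = 0")
    case False
    then show ?thesis
      using min[OF False] pos[OF False] by (simp add: q_def B_def inner_diff_left pos_le_divide_eq)
  qed (simp add: B_def H.zero)
  have Bx: "B x \<bullet> x = 0" using pos[OF x0] by (simp add: B_def q_def inner_diff_left)
  have Bsym: "B h \<bullet> k = B k \<bullet> h" for h k by (simp add: B_def inner_diff_left H N)
  \<comment> \<open>\<open>B\<close> is a nonnegative symmetric form vanishing at \<open>x\<close>; moving from \<open>x\<close> against \<open>B x\<close> would make it
    negative.\<close>
  have "B x = 0"
  proof (rule ccontr)
    assume nz: "B x \<noteq> 0"
    define y c where "y = B x" and "c = B (B x) \<bullet> B x"
    have le: "2 * (norm y)\<^sup>2 \<le> t * c" if t: "t > 0" for t
    proof -
      have Blin: "B (x - t *\<^sub>R y) = B x - t *\<^sub>R B y"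
        by (simp add: B_def H.diff N.diff H.scaleR N.scaleR algebra_simps)
      have "B (x - t *\<^sub>R y) \<bullet> (x - t *\<^sub>R y) = t * (t * c - 2 * (norm y)\<^sup>2)"
        using Bx Bsym[of y x] unfolding Blin
        by (simp add: y_def c_def inner_diff_left inner_diff_right power2_norm_eq_inner algebra_simps)
      then have "0 \<le> t * (t * c - 2 * (norm y)\<^sup>2)" using B[of "x - t *\<^sub>R y"] by simp
      then show ?thesis using t by (simp add: zero_le_mult_iff)
    qed
    have c: "c \<ge> 0" by (simp add: c_def B)
    have y: "(norm y)\<^sup>2 > 0" using nz by (simp add: y_def)
    have "(norm y)\<^sup>2 / (c + 1) * c \<le> (norm y)\<^sup>2"
      using c y by (simp add: pos_divide_le_eq divide_le_eq mult_le_cancel_left_pos)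
    then show False
      using le[of "(norm y)\<^sup>2 / (c + 1)"] c y by (simp add: zero_less_divide_iff)
  qed
  then have "H x = q x *\<^sub>R N x" by (simp add: B_def)
  moreover have "q x \<le> a"
    using order.trans[OF min[OF e(1)], of a] e pos[OF e(1)] by (simp add: q_def[of e] pos_divide_le_eq)
  ultimately show ?thesis using that x0 by blast
qed

section \<open>Touching by radial powers\<close>

lemma C1_on_differentiable: "C1_on f \<Omega> \<Longrightarrow> x \<in> \<Omega> \<Longrightarrow> f differentiable (at x)"
  by (auto simp: C1_on_def differentiable_def)

lemma grad_has_derivative:
  fixes u :: "real ^ 'n \<Rightarrow> real"
  assumes "u differentiable (at x)"
  shows "(u has_derivative (\<lambda>h. grad u x \<bullet> h)) (at x)"
proof -
  let ?D = "frechet_derivative u (at x)"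
  have D: "(u has_derivative ?D) (at x)" using assms frechet_derivative_works by blast
  interpret linear ?D using has_derivative_linear[OF D] .
  have "?D h = grad u x \<bullet> h" for h
  proof -
    have "?D h = ?D (\<Sum>i\<in>UNIV. (h $ i) *\<^sub>R axis i 1)"
      using basis_expansion[of h] by (simp add: scalar_mult_eq_scaleR)
    also have "\<dots> = (\<Sum>i\<in>UNIV. h $ i * ?D (axis i 1))" by (simp add: sum scaleR)
    finally show ?thesis by (simp add: grad_def inner_vec_def mult.commute)
  qed
  then show ?thesis using has_derivative_eq_rhs[OF D] by (simp add: fun_eq_iff)
qed

lemma grad_eqI:
  fixes u :: "real ^ 'n \<Rightarrow> real"
  assumes "(u has_derivative (\<lambda>h. G \<bullet> h)) (at x)"
  shows "grad u x = G"
  using frechet_derivative_at[OF assms, symmetric]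
  by (simp add: grad_def vec_eq_iff inner_axis)

text \<open>
  Where \<open>Du = 0\<close> both sides vanish. Hence \<open>Du\<close> is recovered from the field \<open>|Du|\<^sup>p\<^sup>-\<^sup>2 Du\<close> by a
  map that is smooth away from the origin: there \<open>u\<close> is twice differentiable although only the
  field is assumed to be \<open>C\<^sup>1\<close>.
\<close>
lemma p_field_inverse:
  fixes u :: "real ^ 'n \<Rightarrow> real"
  assumes "p > 1"
  shows "norm (p_field p u z) powr ((2 - p) / (p - 1)) *\<^sub>R p_field p u z = grad u z"
proof (cases "grad u z = 0")
  case False
  define G where "G = grad u z"
  have G: "norm G > 0" using False by (simp add: G_def)
  have "norm (p_field p u z) = norm G powr (p - 2) * norm G" by (simp add: p_field_def G_def)
  also have "\<dots> = norm G powr (p - 1)" using G powr_add[of "norm G" "p - 2" 1] by simp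
  finally have "norm (p_field p u z) powr ((2 - p) / (p - 1)) = norm G powr (2 - p)"
    using assms by (simp add: powr_powr)
  moreover have "norm G powr (2 - p) * norm G powr (p - 2) = 1"
    using G by (simp flip: powr_add)
  ultimately show ?thesis by (simp add: p_field_def G_def[symmetric] flip: mult.assoc)
qed (simp add: p_field_def)

text \<open>
  Let \<open>N\<close> be the derivative at \<open>W = |Du|\<^sup>p\<^sup>-\<^sup>2 Du\<close> of the inverse map \<open>w \<mapsto> |w|\<^sup>\<gamma> w\<close> and \<open>A = DW\<close>.
  Then \<open>N A = D\<^sup>2u\<close> is symmetric and \<open>N\<close> is positive definite, so that the eigenvalues of the (in
  general not symmetric) matrix \<open>A\<close> are those of the pencil \<open>(D\<^sup>2u, N)\<close>. For \<open>v\<close> the same pencil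
  has the eigenvalue \<open>a = \<tau> b\<close> in the radial direction \<open>e\<close> and \<open>b\<close> orthogonally to it, and
  \<open>q \<le> p/(p-1)\<close> means \<open>a \<le> b\<close>.
\<close>
lemma touching_radial_power:
  fixes u :: "real ^ 'n \<Rightarrow> real"
  assumes u: "u \<in> admissible p (Suc m) UNIV" and p: "p > 1"
    and Bq: "B * q > 0" and q: "q \<le> p / (p - 1)" and xy: "x \<noteq> y" and d: "d > 0"
    and max: "\<And>z. z \<in> ball x d \<Longrightarrow>
      u z - B * norm (z - y) powr q \<le> u x - B * norm (x - y) powr q"
  defines "\<tau> \<equiv> (q - 1) * (p - 1)"
  defines "b \<equiv> (B * q) powr (p - 1) * norm (x - y) powr (\<tau> - 1)"
  shows "p_k_Hessian (Suc m) p u x \<le>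
    b ^ Suc m * (real (CARD('n) - 1 choose Suc m) + real (CARD('n) - 1 choose m) * \<tau>)"
proof -
  define g where "g = grad u"
  define W where "W = p_field p u"
  define \<gamma> where "\<gamma> = (2 - p) / (p - 1)"
  define r where "r = norm (x - y)"
  define e where "e = (x - y) /\<^sub>R r"
  define g0 where "g0 = B * q * r powr (q - 1)"
  have r: "r > 0" using xy by (simp add: r_def)
  have g0: "g0 > 0" using Bq r by (simp add: g0_def)
  have e: "norm e = 1" "x - y = r *\<^sub>R e" using r by (simp_all add: e_def r_def)
  have rq: "r powr (q - 1) = r powr (q - 2) * r" using powr_add[of r "q - 2" 1] r by simp
  have rq': "r powr (q - 2) = r powr (q - 2 - 2) * r * r"
    using powr_add[of r "q - 2 - 2" 2] r by (simp add: power2_eq_square)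
  have u': "(u has_derivative (\<lambda>h. g z \<bullet> h)) (at z)" for z
    using u grad_has_derivative C1_on_differentiable[of u UNIV] by (auto simp: admissible_def g_def)
  define gv where "gv z = (B * q) *\<^sub>R (norm (z - y) powr (q - 2) *\<^sub>R (z - y))" for z
  have v': "((\<lambda>z. B * norm (z - y) powr q) has_derivative (\<lambda>h. gv z \<bullet> h)) (at z)" if "z \<noteq> y" for z
  proof -
    have 1: "((\<lambda>z. z - y) has_derivative (\<lambda>h. h)) (at z)" by (auto intro!: derivative_eq_intros)
    have "z - y \<noteq> 0" using that by simp
    from has_derivative_mult_right[OF has_derivative_compose[OF 1 has_derivative_norm_powr[OF this]], of B q]
    show ?thesis by (rule has_derivative_eq_rhs) (simp add: gv_def mult_ac)
  qed
  define d' where "d' = min d r"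
  have d': "d' > 0" using d r by (simp add: d'_def)
  have near: "z \<noteq> y" "z \<in> ball x d" if "z \<in> ball x d'" for z
    using that by (auto simp: d'_def r_def dist_norm)
  have w': "((\<lambda>z. u z - B * norm (z - y) powr q) has_derivative (\<lambda>h. (g z - gv z) \<bullet> h)) (at z)"
    if "z \<in> ball x d'" for z
    using has_derivative_diff[OF u' v'[OF near(1)[OF that]]] by (simp add: inner_diff_left)
  have xd': "x \<in> ball x d'" using d' by simp
  have "\<forall>z\<in>ball x d'. u z - B * norm (z - y) powr q \<le> u x - B * norm (x - y) powr q"
    using max near(2) by blast
  then have "(\<lambda>h. (g x - gv x) \<bullet> h) = (\<lambda>_. 0)"
    using differential_zero_maxmin[OF xd' open_ball w'[OF xd']] by blast
  from fun_cong[OF this, of "g x - gv x"] have "(g x - gv x) \<bullet> (g x - gv x) = 0" .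
  then have gx: "g x = gv x" by simp
  have gve: "gv x = g0 *\<^sub>R e"
    using r by (simp add: gv_def e(2) g0_def e(1) rq)
  define \<omega> where "\<omega> = g0 powr (p - 1)"
  have \<omega>: "\<omega> > 0" using g0 by (simp add: \<omega>_def)
  have Wx: "W x = \<omega> *\<^sub>R e"
    using gx gve g0 e powr_add[of g0 "p - 2" 1] by (simp add: W_def p_field_def g_def \<omega>_def)
  have nW: "norm (W x) = \<omega>" using Wx e \<omega> by simp
  define A where "A = p_jacobian p u x"
  have "W differentiable (at x)"
    using u C1_on_differentiable by (auto simp: admissible_def W_def)
  then have W': "(W has_derivative (\<lambda>h. A *v h)) (at x)"
    unfolding A_def p_jacobian_def W_def[symmetric] by (simp flip: jacobian_works)
  define N where "N h = \<omega> powr \<gamma> *\<^sub>R (h + (\<gamma> * (e \<bullet> h)) *\<^sub>R e)" for h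
  have N': "((\<lambda>w. norm w powr \<gamma> *\<^sub>R w) has_derivative N) (at (W x))"
  proof -
    have nz: "W x \<noteq> 0" using nW \<omega> by auto
    have "\<omega> powr \<gamma> = \<omega> powr (\<gamma> - 2) * \<omega> * \<omega>"
      using powr_add[of \<omega> "\<gamma> - 2" 2] \<omega> by (simp add: power2_eq_square)
    then show ?thesis
      using has_derivative_norm_powr_scaleR[OF nz, of \<gamma>]
      by (simp add: nW) (simp add: Wx N_def[abs_def] scaleR_add_right mult_ac)
  qed
  have "g = (\<lambda>z. norm (W z) powr \<gamma> *\<^sub>R W z)"
    unfolding g_def W_def \<gamma>_def by (rule ext) (rule p_field_inverse[OF p, symmetric])
  then have g': "(g has_derivative (\<lambda>h. N (A *v h))) (at x)"
    using has_derivative_compose[OF W' N'] by presburger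
  define Hv where "Hv h = (g0 / r) *\<^sub>R (h + ((q - 2) * (e \<bullet> h)) *\<^sub>R e)" for h
  have gv': "(gv has_derivative Hv) (at x)"
  proof -
    have 1: "((\<lambda>z. z - y) has_derivative (\<lambda>h. h)) (at x)" by (auto intro!: derivative_eq_intros)
    have 2: "x - y \<noteq> 0" using xy by simp
    have "(gv has_derivative (\<lambda>h. (B * q) *\<^sub>R (norm (x - y) powr (q - 2) *\<^sub>R h
        + ((q - 2) * norm (x - y) powr (q - 2 - 2) * ((x - y) \<bullet> h)) *\<^sub>R (x - y)))) (at x)"
      unfolding gv_def
      by (rule has_derivative_scaleR_right[OF has_derivative_compose[OF 1 has_derivative_norm_powr_scaleR[OF 2]]])
    moreover have "(\<lambda>h. (B * q) *\<^sub>R (norm (x - y) powr (q - 2) *\<^sub>R h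
        + ((q - 2) * norm (x - y) powr (q - 2 - 2) * ((x - y) \<bullet> h)) *\<^sub>R (x - y))) = Hv"
      using r
      by (intro ext, simp add: e(2) e(1) Hv_def g0_def rq scaleR_add_right) (simp add: rq' mult_ac)
    ultimately show ?thesis by (rule has_derivative_eq_rhs)
  qed
  have H_le: "N (A *v h) \<bullet> h \<le> Hv h \<bullet> h" for h
  proof -
    have "(N (A *v h) - Hv h) \<bullet> h \<le> 0"
    proof (rule second_derivative_at_local_max[OF w' d' _ has_derivative_diff[OF g' gv']])
      show "u z - B * norm (z - y) powr q \<le> u x - B * norm (x - y) powr q"
        if "z \<in> ball x d'" for z using max near(2) that by blast
    qed (use gx in auto)
    then show ?thesis by (simp add: inner_diff_left)
  qed
  have H_sym: "N (A *v h) \<bullet> k = N (A *v k) \<bullet> h" for h k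
    by (rule gradient_derivative_symmetric[OF u' g'])
  have \<gamma>: "\<gamma> + 1 = 1 / (p - 1)" using p by (simp add: \<gamma>_def field_simps)
  have eh: "(e \<bullet> h)\<^sup>2 \<le> (norm h)\<^sup>2" for h
    using Cauchy_Schwarz_ineq[of e h] e by (simp add: power2_norm_eq_inner norm_eq_1)
  have Nh: "N h \<bullet> h = \<omega> powr \<gamma> * ((norm h)\<^sup>2 + \<gamma> * (e \<bullet> h)\<^sup>2)" for h
    by (simp add: N_def inner_add_left power2_norm_eq_inner) (simp add: power2_eq_square)
  have Hvh: "Hv h \<bullet> h = g0 / r * ((norm h)\<^sup>2 + (q - 2) * (e \<bullet> h)\<^sup>2)" for h
    by (simp add: Hv_def inner_add_left power2_norm_eq_inner) (simp add: power2_eq_square)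
  have N_pos: "N h \<bullet> h > 0" if "h \<noteq> 0" for h
  proof -
    have "0 < (norm h)\<^sup>2 + \<gamma> * (e \<bullet> h)\<^sup>2"
    proof (cases "\<gamma> \<ge> 0")
      case True
      then show ?thesis using that by (intro add_pos_nonneg) auto
    next
      case False
      have "0 < (\<gamma> + 1) * (norm h)\<^sup>2" using \<gamma> p that by simp
      moreover have "\<gamma> * (norm h)\<^sup>2 \<le> \<gamma> * (e \<bullet> h)\<^sup>2"
        using False eh by (intro mult_left_mono_neg) auto
      ultimately show ?thesis by (simp add: algebra_simps)
    qed
    then show ?thesis using \<omega> by (simp add: Nh)
  qed
  have N_lin: "linear N"
    using N' has_derivative_linear by blast
  have N_sym: "N h \<bullet> k = N k \<bullet> h" for h k
    by (simp add: N_def inner_add_left) (simp add: inner_commute[of h k])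
  have b: "b = g0 powr (p - 1) / r"
  proof -
    have "(c * t) powr a = c powr a * t powr a" if "c > 0" "t > 0" for a c t :: real
      using that by (simp add: powr_mult)
    from this[OF Bq, of "r powr (q - 1)" "p - 1"] r
    have "g0 powr (p - 1) = (B * q) powr (p - 1) * r powr \<tau>"
      by (simp add: g0_def powr_powr \<tau>_def)
    then show ?thesis
      using r by (simp add: b_def powr_diff flip: r_def)
  qed
  have b\<omega>: "b * \<omega> powr \<gamma> = g0 / r"
  proof -
    have "\<omega> powr \<gamma> = g0 powr (2 - p)" using p by (simp add: \<omega>_def powr_powr \<gamma>_def)
    then show ?thesis using g0 by (simp add: b flip: powr_add)
  qed
  \<comment> \<open>No eigenvalue exceeds \<open>b\<close>, because \<open>D\<^sup>2u \<le> D\<^sup>2v \<le> b N\<close>.\<close>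
  have bN: "Hv h \<bullet> h \<le> b * (N h \<bullet> h)" for h
  proof -
    have "q - 2 \<le> \<gamma>" using q p by (simp add: \<gamma>_def field_simps)
    then have "g0 / r * ((norm h)\<^sup>2 + (q - 2) * (e \<bullet> h)\<^sup>2) \<le> g0 / r * ((norm h)\<^sup>2 + \<gamma> * (e \<bullet> h)\<^sup>2)"
      using g0 r by (intro mult_left_mono add_left_mono mult_right_mono) auto
    then show ?thesis by (simp add: Nh Hvh flip: b\<omega> mult.assoc)
  qed
  \<comment> \<open>In the radial direction \<open>D\<^sup>2v\<close> equals \<open>a N\<close>, which makes the least eigenvalue at most \<open>a\<close>.\<close>
  have aN: "Hv e \<bullet> e = (\<tau> * b) * (N e \<bullet> e)"
  proof -
    have "e \<bullet> e = 1" using e by (simp add: norm_eq_1)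
    then have "(\<tau> * b) * (N e \<bullet> e) = \<tau> * (g0 / r) * (\<gamma> + 1)"
      using e by (simp add: Nh algebra_simps flip: b\<omega>)
    also have "\<dots> = g0 / r * (q - 1)" using p by (simp add: \<gamma> \<tau>_def)
    also have "\<dots> = Hv e \<bullet> e" using e \<open>e \<bullet> e = 1\<close> by (simp add: Hvh algebra_simps)
    finally show ?thesis ..
  qed
  have e0: "e \<noteq> 0" using e by auto
  have H_lin: "linear (\<lambda>h. N (A *v h))" using g' has_derivative_linear by blast
  obtain z t where z: "z \<noteq> 0" "t \<le> \<tau> * b" "N (A *v z) = t *\<^sub>R N z"
    using rayleigh_minimum[OF H_lin N_lin H_sym N_sym N_pos e0] H_le[of e] aN by metis
  interpret N: linear N by (rule N_lin)
  have "N (A *v z - t *\<^sub>R z) = 0" using z by (simp add: N.diff N.scaleR)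
  then have Az: "A *v z = t *\<^sub>R z" using N_pos[of "A *v z - t *\<^sub>R z"] by fastforce
  have ev: "s \<le> b" if "h \<noteq> 0" "A *v h = s *\<^sub>R h" for s h
  proof -
    have "s * (N h \<bullet> h) \<le> b * (N h \<bullet> h)"
      using H_le[of h] bN[of h] that by (simp add: N.scaleR)
    then show ?thesis using N_pos[OF that(1)] by simp
  qed
  have "eigvals_in A (Gamma_cone (Suc m))" using u by (auto simp: admissible_def A_def)
  from elem_sym_eigvals_le[OF this ev Az z(1,2)] show "p_k_Hessian (Suc m) p u x \<le>
    b ^ Suc m * (real (CARD('n) - 1 choose Suc m) + real (CARD('n) - 1 choose m) * \<tau>)"
    by (simp add: p_k_Hessian_def A_def algebra_simps)
qed

section \<open>Comparison with radial powers\<close>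

lemma has_derivative_norm_powr_at_0:
  fixes q :: real
  assumes "q > 1"
  shows "((\<lambda>x::'a::real_normed_vector. norm x powr q) has_derivative (\<lambda>h. 0)) (at 0)"
proof -
  have "((\<lambda>t::real. t powr (q - 1)) \<longlongrightarrow> 0 powr (q - 1)) (at_right 0)"
    using assms by (intro tendsto_powr' tendsto_intros) (auto simp: eventually_at_right_field intro: exI[of _ 1])
  then have "((\<lambda>t::real. t powr (q - 1)) \<longlongrightarrow> 0) (at_right 0)" by simp
  moreover have "filterlim norm (at_right 0) (at (0::'a))"
    unfolding filterlim_at by (auto intro!: tendsto_norm_zero tendsto_intros simp: eventually_at intro: exI[of _ 1])
  ultimately have "((\<lambda>h::'a. norm h powr (q - 1)) \<longlongrightarrow> 0) (at 0)"
    by (rule filterlim_compose)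
  note lim = this
  have eq: "norm h powr (q - 1) = norm (norm (0 + h) powr q - norm (0::'a) powr q - 0) / norm h"
    if "h \<noteq> 0" for h :: 'a
    using that assms by (simp add: powr_diff)
  from lim have "((\<lambda>h::'a. norm (norm (0 + h) powr q - norm (0::'a) powr q - 0) / norm h) \<longlongrightarrow> 0) (at 0)"
    by (rule Lim_transform_eventually) (auto simp: eventually_at eq[simplified] intro!: exI[of _ 1])
  then show ?thesis unfolding has_derivative_at by simp
qed

lemma has_derivative_norm_powr_at_any:
  fixes x :: "'a::real_inner"
  assumes "x \<noteq> 0 \<or> q > 1"
  shows "((\<lambda>x. norm x powr q) has_derivative (\<lambda>h. q * norm x powr (q - 2) * (x \<bullet> h))) (at x)"
  using has_derivative_norm_powr[of x q] has_derivative_norm_powr_at_0[of q] assms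
  by (cases "x = 0") auto

text \<open>
  This is \<open>(n choose k) / n\<close>, the factor in \<open>\<sigma>_k(t, 1, ..., 1) = ((n choose k) / n) (n - k + k t)\<close>
  for tuples of length \<open>n\<close>.
\<close>
definition hessian_const :: "nat \<Rightarrow> nat \<Rightarrow> real" where
  "hessian_const n k = real (n - 1 choose (k - 1)) / real k"

lemma hessian_const_pos: "1 \<le> k \<Longrightarrow> k \<le> n \<Longrightarrow> hessian_const n k > 0"
  by (auto simp: hessian_const_def intro!: divide_pos_pos zero_less_binomial)

lemma binomial_hessian_const:
  assumes "Suc m \<le> n"
  shows "real (n - 1 choose Suc m) + real (n - 1 choose m) * t =
    hessian_const n (Suc m) * (real n - real (Suc m) + real (Suc m) * t)"
proof -
  have "Suc m * (n - 1 choose Suc m) = (n - 1 - m) * (n - 1 choose m)"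
    using assms binomial_absorb_comp[of "n - 1" m] Suc_times_binomial_eq[of "n - 2" m]
    by (metis binomial_absorption binomial_absorb_comp Suc_times_binomial_add mult.commute)
  then have "real (Suc m) * real (n - 1 choose Suc m) = real (n - 1 - m) * real (n - 1 choose m)"
    by (metis of_nat_mult)
  then show ?thesis using assms by (simp add: hessian_const_def field_simps of_nat_diff)
qed

text \<open>
  The value of the operator on \<open>A + B |x - y|\<^sup>q\<close> at distance \<open>r\<close> from \<open>y\<close>, when \<open>B q > 0\<close>.
\<close>
definition radial_hessian :: "nat \<Rightarrow> nat \<Rightarrow> real \<Rightarrow> real \<Rightarrow> real \<Rightarrow> real \<Rightarrow> real" where
  "radial_hessian n k p B q r = hessian_const n k * (real n - real k + real k * ((q - 1) * (p - 1)))
     * (B * q) powr (real k * (p - 1)) * r powr (real k * ((q - 1) * (p - 1) - 1))"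

lemma touching_radial_hessian:
  fixes u :: "real ^ 'n \<Rightarrow> real"
  assumes u: "u \<in> admissible p k UNIV" and k: "1 \<le> k" "k \<le> CARD('n)" and p: "p > 1"
    and Bq: "B * q > 0" and q: "q \<le> p / (p - 1)" and xy: "x \<noteq> y" and d: "d > 0"
    and max: "\<And>z. z \<in> ball x d \<Longrightarrow>
      u z - B * norm (z - y) powr q \<le> u x - B * norm (x - y) powr q"
  shows "p_k_Hessian k p u x \<le> radial_hessian CARD('n) k p B q (norm (x - y))"
proof -
  obtain m where m: "k = Suc m" using k by (cases k) auto
  define \<tau> where "\<tau> = (q - 1) * (p - 1)"
  define r where "r = norm (x - y)"
  have r: "r > 0" using xy by (simp add: r_def)
  define b where "b = (B * q) powr (p - 1) * r powr (\<tau> - 1)"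
  have "p_k_Hessian (Suc m) p u x \<le>
    b ^ Suc m * (real (CARD('n) - 1 choose Suc m) + real (CARD('n) - 1 choose m) * \<tau>)"
    using touching_radial_power[OF _ p Bq q xy d max] u unfolding m b_def r_def \<tau>_def by blast
  also have "real (CARD('n) - 1 choose Suc m) + real (CARD('n) - 1 choose m) * \<tau> =
      hessian_const CARD('n) k * (real CARD('n) - real k + real k * \<tau>)"
    unfolding m using k m by (intro binomial_hessian_const) simp
  also have "b ^ Suc m = (B * q) powr (real k * (p - 1)) * r powr (real k * (\<tau> - 1))"
  proof -
    have "B \<noteq> 0 \<and> q \<noteq> 0" using Bq by (metis less_irrefl mult_zero_left mult_zero_right)
    then have "b > 0" unfolding b_def using r by (intro mult_pos_pos) auto
    then have "b ^ Suc m = b powr real k" using powr_realpow[of b "Suc m"] m by simp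
    also have "\<dots> = ((B * q) powr (p - 1)) powr real k * (r powr (\<tau> - 1)) powr real k"
      unfolding b_def by (rule powr_mult)
    finally show ?thesis by (simp add: powr_powr mult.commute)
  qed
  finally show ?thesis
    by (simp add: radial_hessian_def m \<tau>_def r_def mult_ac)
qed

lemma admissible_has_derivative:
  "u \<in> admissible p k UNIV \<Longrightarrow> (u has_derivative (\<lambda>h. grad u x \<bullet> h)) (at x)"
  using grad_has_derivative C1_on_differentiable[of u UNIV] by (auto simp: admissible_def)

text \<open>
  If \<open>u - v\<close> exceeded its boundary values, then it would have a maximum where \<open>F[u] \<le> F[v]\<close>. The
  inner radius may be \<open>0\<close>: then \<open>Dv(y) = 0\<close> since \<open>q > 1\<close>, and the maximum is not at \<open>y\<close> because
  \<open>Du(y) \<noteq> 0\<close>.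
\<close>
lemma comparison_radial_power:
  fixes u :: "real ^ 'n \<Rightarrow> real"
  assumes u: "u \<in> admissible p k UNIV" and k: "1 \<le> k" "k \<le> CARD('n)" and p: "p > 1"
    and Bq: "B * q > 0" and q: "q \<le> p / (p - 1)" and r0: "0 \<le> r0"
    and inner: "\<And>x. norm (x - y) = r0 \<Longrightarrow>
      u x \<le> A + B * r0 powr q \<or> r0 = 0 \<and> q > 1 \<and> grad u x \<noteq> 0"
    and outer: "\<And>x. norm (x - y) = R \<Longrightarrow> u x \<le> A + B * R powr q"
    and less: "\<And>x. r0 < norm (x - y) \<Longrightarrow> norm (x - y) < R \<Longrightarrow> A + B * norm (x - y) powr q < u x
      \<Longrightarrow> radial_hessian CARD('n) k p B q (norm (x - y)) < p_k_Hessian k p u x"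
    and q0: "r0 > 0 \<or> q > 1"
    and x: "r0 \<le> norm (x - y)" "norm (x - y) \<le> R"
  shows "u x \<le> A + B * norm (x - y) powr q"
proof (rule ccontr)
  assume "\<not> ?thesis"
  then have x_gt: "A + B * norm (x - y) powr q < u x" by simp
  define w where "w z = u z - B * norm (z - y) powr q" for z
  define S where "S = {z. r0 \<le> norm (z - y) \<and> norm (z - y) \<le> R}"
  have S: "S = cball y R - ball y r0" by (auto simp: S_def dist_norm norm_minus_commute)
  have der: "(w has_derivative (\<lambda>h. (grad u z - (B * q * norm (z - y) powr (q - 2)) *\<^sub>R (z - y)) \<bullet> h)) (at z)"
    if "z \<noteq> y \<or> q > 1" for z
  proof -
    have 1: "((\<lambda>z. z - y) has_derivative (\<lambda>h. h)) (at z)" by (auto intro!: derivative_eq_intros)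
    have 2: "z - y \<noteq> 0 \<or> q > 1" using that by auto
    show ?thesis
      unfolding w_def
      by (rule has_derivative_eq_rhs[OF has_derivative_diff[OF admissible_has_derivative[OF u]
            has_derivative_mult_right[OF has_derivative_compose[OF 1 has_derivative_norm_powr_at_any[OF 2]]]]])
         (simp add: inner_diff_left mult_ac)
  qed
  have "isCont w z" if "z \<in> S" for z
    using der[of z] q0 that has_derivative_continuous[of w _ z] by (force simp: S_def)
  then have "continuous_on S w" by (simp add: continuous_at_imp_continuous_on)
  moreover have "compact S" unfolding S by (intro compact_diff) auto
  moreover have "x \<in> S" using x by (simp add: S_def)
  ultimately obtain z where z: "z \<in> S" "\<And>z'. z' \<in> S \<Longrightarrow> w z' \<le> w z"
    using continuous_attains_sup[of S w] by blast
  have "A < w x" using x_gt by (simp add: w_def)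
  then have wz: "A < w z" using z(2)[OF \<open>x \<in> S\<close>] by simp
  have zR: "norm (z - y) < R"
    using outer[of z] wz z(1) by (cases "norm (z - y) = R") (auto simp: w_def S_def)
  show False
  proof (cases "norm (z - y) = r0")
    case True
    with inner[OF True] wz have r: "r0 = 0" "q > 1" "grad u z \<noteq> 0"
      by (auto simp: w_def)
    then have zy: "z = y" using True by simp
    have "R > 0" using zR by (rule le_less_trans[OF norm_ge_zero])
    moreover have "ball z R \<subseteq> S" using r zy by (auto simp: S_def dist_norm norm_minus_commute)
    ultimately have "(\<lambda>h. (grad u z - (B * q * norm (z - y) powr (q - 2)) *\<^sub>R (z - y)) \<bullet> h) = (\<lambda>_. 0)"
      using z zR r by (intro differential_zero_maxmin[of z "ball z R" w]) (auto intro!: der)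
    from fun_cong[OF this, of "grad u z"] show False using r zy by simp
  next
    case False
    then have zr: "r0 < norm (z - y)" using z(1) by (simp add: S_def)
    define d where "d = min (norm (z - y) - r0) (R - norm (z - y))"
    have d: "d > 0" using zr zR by (simp add: d_def)
    have "ball z d \<subseteq> S"
    proof
      fix z' assume "z' \<in> ball z d"
      then have "norm (z' - z) < d" by (simp add: dist_norm norm_minus_commute)
      moreover have "norm (z - y) - norm (z' - z) \<le> norm (z' - y)" "norm (z' - y) \<le> norm (z - y) + norm (z' - z)"
        using norm_triangle_ineq[of "z' - z" "z - y"] norm_triangle_ineq2[of "z - y" "z - z'"]
        by (auto simp: norm_minus_commute)
      ultimately show "z' \<in> S" by (auto simp: S_def d_def)
    qed
    then have "p_k_Hessian k p u z \<le> radial_hessian CARD('n) k p B q (norm (z - y))"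
      using zr r0 z(2) by (intro touching_radial_hessian[OF u k p Bq q _ d]) (auto simp: w_def)
    moreover have "A + B * norm (z - y) powr q < u z" using wz by (simp add: w_def)
    ultimately show False using less[OF zr zR] by simp
  qed
qed

text \<open>
  If \<open>Du\<close> vanished identically, so would the field, its Jacobian and all the eigenvalues.
\<close>
lemma exists_grad_nonzero:
  fixes u :: "real ^ 'n \<Rightarrow> real"
  assumes k: "k \<ge> 1" and "p_k_Hessian k p u x \<noteq> 0"
  shows "\<exists>y. grad u y \<noteq> 0"
proof (rule ccontr)
  assume "\<not> ?thesis"
  then have "p_field p u = (\<lambda>_. 0)" by (auto simp: p_field_def)
  then have "p_jacobian p u x = 0"
    by (simp add: p_jacobian_def jacobian_def matrix_def vec_eq_iff)
  then show False using assms elem_sym_eigvals_zero[of k, where 'n = 'n] by (simp add: p_k_Hessian_def)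
qed

section \<open>Nonexistence up to the critical exponent\<close>

text \<open>
  The critical inequality is only required where \<open>-u < 2 (-u(y))\<close>. In this form it follows from
  the inequality with any exponent \<open>\<alpha> \<le> k_*\<close>, and it is enough, as only such points arise in the
  comparisons. The parameters \<open>n\<close>, \<open>ks\<close> and \<open>\<kappa>\<close> are abbreviations for quantities that depend on
  the dimension.
\<close>
locale entire_subsolution =
  fixes u :: "real ^ 'n \<Rightarrow> real" and y :: "real ^ 'n" and k :: nat and p c n ks \<kappa> :: real
  assumes n: "n = real CARD('n)" and ks: "ks = k_star CARD('n) k p" and \<kappa>: "\<kappa> = hessian_const CARD('n) k"
    and adm: "u \<in> admissible p k UNIV" and k: "1 \<le> k" and p: "1 < p" and pk: "p * real k < n"
    and neg: "u x < 0" and hess_pos: "0 < p_k_Hessian k p u x"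
    and grad: "grad u y \<noteq> 0" and c: "c > 0"
    and crit: "- u x < 2 * (- u y) \<Longrightarrow> c * (- u x) powr ks \<le> p_k_Hessian k p u x"
begin

text \<open>
  \<open>d\<close> is the degree of homogeneity of the operator and \<open>\<theta>\<close> the decay exponent of the fundamental
  solution; \<open>h\<close> compares the minimum \<open>m\<close> of \<open>-u\<close> with that decay.
\<close>
definition "d = real k * (p - 1)"
definition "\<theta> = (n - p * real k) / d"
definition "m r = (INF x\<in>cball y r. - u x)"
definition "h r = m r * r powr \<theta>"

lemma k_le: "k \<le> CARD('n)"
proof -
  have "real k \<le> p * real k" using p mult_right_mono[of 1 p "real k"] by simp
  then show ?thesis using pk n by linarith
qed

lemma kappa_pos: "\<kappa> > 0"
  unfolding \<kappa> by (rule hessian_const_pos[OF k k_le])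

lemma d_pos: "d > 0"
  using k p by (simp add: d_def)

lemma theta_pos: "\<theta> > 0"
  using d_pos pk by (simp add: \<theta>_def)

lemma ks_eq: "ks = n * d / (n - p * real k)"
  by (simp add: ks k_star_def d_def mult_ac flip: n)

lemma theta_ks: "\<theta> * ks = n"
  using pk d_pos by (simp add: \<theta>_def ks_eq)

lemma ks_gt: "ks > d"
proof -
  have "d * (n - p * real k) < d * n" using d_pos k p by (intro mult_strict_left_mono) auto
  then show ?thesis using pk by (simp add: ks_eq pos_less_divide_eq mult.commute)
qed

text \<open>
  The exponent \<open>\<beta> = ks / d\<close> occurs in the doubling estimate for \<open>m\<close>; this identity makes that
  estimate scale like the fundamental solution.
\<close>
lemma theta_ratio: "\<theta> * (ks / d - 1) = p / (p - 1)"
proof -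
  have "\<theta> * (ks / d - 1) = (\<theta> * ks - \<theta> * d) / d" using d_pos by (simp add: field_simps)
  also have "\<dots> = p * real k / d" using d_pos by (simp add: theta_ks) (simp add: \<theta>_def)
  finally show ?thesis using k p by (simp add: d_def)
qed

lemma continuous_on_minus_u: "continuous_on S (\<lambda>x. - u x)"
  using admissible_has_derivative[OF adm] has_derivative_continuous
  by (intro continuous_on_minus continuous_at_imp_continuous_on) blast

lemma m_attained:
  assumes "r \<ge> 0"
  obtains x where "norm (x - y) \<le> r" "m r = - u x"
proof -
  obtain x where x: "x \<in> cball y r" "\<And>z. z \<in> cball y r \<Longrightarrow> - u x \<le> - u z"
    using continuous_attains_inf[OF _ _ continuous_on_minus_u, of "cball y r"] assms by auto
  have "m r = - u x"
    unfolding m_def using x by (intro cInf_eq_minimum) auto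
  with x(1) show ?thesis using that[of x] by (simp add: dist_norm norm_minus_commute)
qed

lemma m_le:
  assumes "norm (x - y) \<le> r"
  shows "m r \<le> - u x"
proof -
  have "bdd_below ((\<lambda>x. - u x) ` cball y r)"
    using neg by (intro bdd_belowI2[of _ 0]) (simp add: less_imp_le)
  then show ?thesis
    unfolding m_def using assms by (intro cINF_lower) (auto simp: dist_norm norm_minus_commute)
qed

lemma m_ge:
  assumes "r \<ge> 0" "\<And>x. norm (x - y) \<le> r \<Longrightarrow> a \<le> - u x"
  shows "a \<le> m r"
  using m_attained[OF assms(1)] assms(2) by metis

lemma m_pos: "r \<ge> 0 \<Longrightarrow> m r > 0"
  using m_attained[of r] neg by (metis neg_0_less_iff_less)

lemma m_le_center: "r \<ge> 0 \<Longrightarrow> m r \<le> - u y"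
  by (rule m_le) simp

lemma p'_gt_1: "p / (p - 1) > 1"
  using p by simp

text \<open>
  The factor of the operator on \<open>|x - y|\<^sup>-\<^sup>t\<close>; it vanishes for \<open>t = \<theta>\<close>.
\<close>
lemma fundamental_exponent: "n - real k + real k * ((- t - 1) * (p - 1)) = (\<theta> - t) * d"
proof -
  have "\<theta> * d = n - p * real k" using d_pos by (simp add: \<theta>_def)
  then show ?thesis by (simp add: left_diff_distrib) (simp add: d_def algebra_simps)
qed

text \<open>
  Comparison on \<open>r0 \<le> |x - y| \<le> R\<close> with the solution of \<open>F[v] = 0\<close> which is \<open>0\<close> on the outer
  sphere and at least \<open>- m r0\<close> on the inner one; then \<open>R\<close> tends to infinity.
\<close>
lemma lower_bound_fundamental:
  assumes r0: "0 < r0" and x: "r0 \<le> norm (x - y)"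
  shows "h r0 * norm (x - y) powr (- \<theta>) \<le> - u x"
proof -
  have h: "h r0 > 0" using r0 m_pos[of r0] by (simp add: h_def)
  have h_r0: "h r0 * r0 powr (- \<theta>) = m r0"
    using r0 by (simp add: h_def powr_minus)
  have bound: "h r0 * (norm (x - y) powr (- \<theta>) - R powr (- \<theta>)) \<le> - u x" if R: "norm (x - y) < R" for R
  proof -
    have "u x \<le> h r0 * R powr (- \<theta>) + (- h r0) * norm (x - y) powr (- \<theta>)"
    proof (rule comparison_radial_power[OF adm k k_le p, where q = "- \<theta>" and R = R and ?r0.0 = r0])
      show "(- h r0) * (- \<theta>) > 0" using h theta_pos by simp
      show "- \<theta> \<le> p / (p - 1)" using theta_pos p'_gt_1 by linarith
      show "u z \<le> h r0 * R powr - \<theta> + - h r0 * r0 powr - \<theta> \<or> r0 = 0 \<and> 1 < - \<theta> \<and> grad u z \<noteq> 0"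
        if "norm (z - y) = r0" for z
      proof -
        have "h r0 * R powr - \<theta> \<ge> 0" using h by simp
        then show ?thesis using m_le[of z r0] that h_r0 by simp
      qed
      show "u z \<le> h r0 * R powr - \<theta> + - h r0 * R powr - \<theta>" for z
        using neg[of z] by simp
      show "radial_hessian CARD('n) k p (- h r0) (- \<theta>) (norm (z - y)) < p_k_Hessian k p u z" for z
        unfolding radial_hessian_def n[symmetric] fundamental_exponent using hess_pos[of z] by simp
    qed (use r0 x R in auto)
    then show ?thesis by (simp add: algebra_simps)
  qed
  have "((\<lambda>R. h r0 * (norm (x - y) powr (- \<theta>) - R powr (- \<theta>))) \<longlongrightarrow> h r0 * (norm (x - y) powr (- \<theta>) - 0)) at_top"
    using theta_pos by (intro tendsto_intros tendsto_neg_powr filterlim_ident) auto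
  moreover have "\<forall>\<^sub>F R in at_top. h r0 * (norm (x - y) powr (- \<theta>) - R powr (- \<theta>)) \<le> - u x"
    using eventually_gt_at_top by eventually_elim (rule bound)
  ultimately have "h r0 * (norm (x - y) powr (- \<theta>) - 0) \<le> - u x"
    by (rule tendsto_upperbound) simp
  then show ?thesis by simp
qed

lemma h_pos: "r > 0 \<Longrightarrow> h r > 0"
  using m_pos[of r] by (simp add: h_def)

lemma h_mono:
  assumes "0 < r" "r \<le> s"
  shows "h r \<le> h s"
proof -
  have "h r * s powr (- \<theta>) \<le> m s"
  proof (rule m_ge)
    fix x assume x: "norm (x - y) \<le> s"
    show "h r * s powr (- \<theta>) \<le> - u x"
    proof (cases "norm (x - y) \<le> r")
      case True
      have "s powr (- \<theta>) \<le> r powr (- \<theta>)" using assms theta_pos by (intro powr_mono2') auto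
      then have "h r * s powr (- \<theta>) \<le> h r * r powr (- \<theta>)"
        using h_pos[OF assms(1)] by (intro mult_left_mono) auto
      also have "\<dots> = m r" using assms by (simp add: h_def powr_minus)
      finally show ?thesis using m_le[OF True] by simp
    next
      case False
      then have "s powr (- \<theta>) \<le> norm (x - y) powr (- \<theta>)"
        using assms x theta_pos by (intro powr_mono2') auto
      then have "h r * s powr (- \<theta>) \<le> h r * norm (x - y) powr (- \<theta>)"
        using h_pos[OF assms(1)] by (intro mult_left_mono) auto
      then show ?thesis using lower_bound_fundamental[OF assms(1), of x] False by simp
    qed
  qed (use assms in auto)
  then have "h r * s powr (- \<theta>) * s powr \<theta> \<le> h s"
    unfolding h_def[of s] by (intro mult_right_mono) auto
  then show ?thesis using assms by (simp add: mult.assoc flip: powr_add)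
qed

text \<open>
  For the exponent \<open>q = p/(p-1)\<close> the operator is constant on \<open>v\<close>, and by \<open>small\<close> this constant
  lies below the right-hand side. The bound \<open>B R\<^sup>q \<le> -u(y)\<close> ensures \<open>-v \<le> 2 (-u(y))\<close>.
\<close>
lemma lower_bound_ball:
  defines "q \<equiv> p / (p - 1)"
  assumes R: "R > 0" and B: "B > 0" "B * R powr q \<le> - u y"
    and small: "\<kappa> * n * (B * q) powr d < c * m R powr ks"
    and x: "norm (x - y) \<le> R"
  shows "m R + B * (R powr q - norm (x - y) powr q) \<le> - u x"
proof -
  have q1: "q > 1" using p'_gt_1 by (simp add: q_def)
  have qp: "(q - 1) * (p - 1) = 1" using p by (simp add: q_def field_simps)
  have "u x \<le> (- m R - B * R powr q) + B * norm (x - y) powr q"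
  proof (rule comparison_radial_power[OF adm k k_le p, where q = q and R = R and ?r0.0 = 0])
    show "B * q > 0" using B q1 by simp
    show "q \<le> p / (p - 1)" by (simp add: q_def)
    show "u z \<le> (- m R - B * R powr q) + B * 0 powr q \<or> 0 = 0 \<and> 1 < q \<and> grad u z \<noteq> 0"
      if "norm (z - y) = 0" for z using that q1 grad by simp
    show "u z \<le> (- m R - B * R powr q) + B * R powr q" if "norm (z - y) = R" for z
      using m_le[of z R] that by simp
    show "radial_hessian CARD('n) k p B q (norm (z - y)) < p_k_Hessian k p u z"
      if z: "0 < norm (z - y)" "norm (z - y) < R"
        and gt: "(- m R - B * R powr q) + B * norm (z - y) powr q < u z" for z
    proof -
      have "- u z < m R + B * R powr q" using gt B by (simp add: algebra_simps) (smt (verit) mult_nonneg_nonneg powr_ge_zero)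
      also have "\<dots> \<le> 2 * (- u y)" using B m_le_center[of R] R by simp
      finally have "c * (- u z) powr ks \<le> p_k_Hessian k p u z" by (rule crit)
      moreover have "m R powr ks \<le> (- u z) powr ks"
        using m_le[of z R] z m_pos[of R] R ks_gt d_pos by (intro powr_mono2) auto
      then have "c * m R powr ks \<le> c * (- u z) powr ks" using c by simp
      moreover have "radial_hessian CARD('n) k p B q (norm (z - y)) = \<kappa> * n * (B * q) powr d"
        using z(1) unfolding radial_hessian_def qp by (simp add: \<kappa> n d_def)
      ultimately show ?thesis using small by linarith
    qed
  qed (use q1 x in auto)
  then show ?thesis by (simp add: algebra_simps)
qed

text \<open>
  The comparison on balls gives \<open>m(R/2) \<ge> C2 m(R)\<^sup>\<beta> R\<^sup>q\<close>, while \<open>m(R/2) \<le> 2\<^sup>\<theta> m(R)\<close> by the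
  monotonicity of \<open>h\<close>. As \<open>\<beta> > 1\<close>, this is an upper bound for \<open>m(R)\<^sup>\<beta>\<^sup>-\<^sup>1 R\<^sup>q = h(R)\<^sup>\<beta>\<^sup>-\<^sup>1\<close>.
\<close>
lemma h_bounded: "\<exists>H. \<forall>R>0. h R \<le> H"
proof -
  define q where "q = p / (p - 1)"
  define \<beta> where "\<beta> = ks / d"
  have q1: "q > 1" using p'_gt_1 by (simp add: q_def)
  have \<beta>: "\<beta> > 1" using ks_gt d_pos by (simp add: \<beta>_def)
  have n0: "n > 0" using n by simp
  \<comment> \<open>Chosen such that the operator on \<open>v\<close>, with \<open>B = C1 m(R)\<^sup>\<beta>\<close>, is half of the right-hand side.\<close>
  define C1 where "C1 = (c / (2 * \<kappa> * n)) powr (1 / d) / q"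
  have C1: "C1 > 0" using q1 c kappa_pos n0 by (simp add: C1_def)
  define C2 where "C2 = C1 * (1 - (1 / 2) powr q)"
  have "(1 / 2 :: real) powr q < (1 / 2) powr 0" using q1 by (intro powr_less_mono') auto
  then have C2: "C2 > 0" using C1 by (simp add: C2_def)
  have "h R \<le> (2 powr \<theta> / C2) powr (1 / (\<beta> - 1))" if R: "R > 0" for R
  proof -
    have m: "m R > 0" using m_pos R by simp
    define B where "B = C1 * m R powr \<beta>"
    have B: "B > 0" using C1 m by (simp add: B_def)
    have "B * q = (c / (2 * \<kappa> * n)) powr (1 / d) * m R powr \<beta>"
      using q1 by (simp add: B_def C1_def)
    then have "(B * q) powr d = c / (2 * \<kappa> * n) * m R powr ks"
      using c kappa_pos n0 m d_pos by (simp add: powr_mult powr_powr \<beta>_def)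
    then have "\<kappa> * n * (B * q) powr d = c * m R powr ks / 2"
      using kappa_pos n0 by simp
    moreover have "c * m R powr ks > 0" using c m by simp
    ultimately have small: "\<kappa> * n * (B * q) powr d < c * m R powr ks" by simp
    \<comment> \<open>Otherwise a smaller coefficient \<open>B'\<close> with \<open>B' R\<^sup>q = -u(y)\<close> satisfies the hypotheses of the comparison, which at the
      centre reads \<open>m R - u(y) \<le> -u(y)\<close>.\<close>
    have BR: "B * R powr q \<le> - u y"
    proof (rule ccontr)
      assume large: "\<not> B * R powr q \<le> - u y"
      define B' where "B' = - u y / R powr q"
      have eq: "B' * R powr q = - u y" using R by (simp add: B'_def)
      have B': "0 < B'" "B' \<le> B" "B' * R powr q = - u y"
      proof -
        show "0 < B'" using neg[of y] R by (simp add: B'_def divide_neg_pos)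
        have "B' * R powr q \<le> B * R powr q" using eq large by linarith
        then show "B' \<le> B" using R by simp
      qed (rule eq)
      have "(B' * q) powr d \<le> (B * q) powr d"
        using B' q1 d_pos by (intro powr_mono2 mult_right_mono) auto
      then have "\<kappa> * n * (B' * q) powr d \<le> \<kappa> * n * (B * q) powr d"
        using kappa_pos n0 by (intro mult_left_mono) auto
      then have small': "\<kappa> * n * (B' * q) powr d < c * m R powr ks" using small by linarith
      have "B' * R powr q \<le> - u y" using eq by simp
      from lower_bound_ball[OF R B'(1), folded q_def, OF this small', of y]
      have "m R + B' * (R powr q - norm (y - y) powr q) \<le> - u y" using R by simp
      then show False using B'(3) m by simp
    qed
    have "m R + B * (R powr q - (R / 2) powr q) \<le> m (R / 2)"
    proof (rule m_ge)
      fix x assume x: "norm (x - y) \<le> R / 2"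
      have "m R + B * (R powr q - (R / 2) powr q) \<le> m R + B * (R powr q - norm (x - y) powr q)"
        using x B q1 by (intro add_left_mono mult_left_mono diff_left_mono powr_mono2) auto
      also have "\<dots> \<le> - u x"
        using lower_bound_ball[OF R B, folded q_def, OF BR small, of x] R x by simp
      finally show "m R + B * (R powr q - (R / 2) powr q) \<le> - u x" .
    qed (use R in auto)
    moreover have "B * (R powr q - (R / 2) powr q) = C2 * m R powr \<beta> * R powr q"
      using R powr_mult[of R "1 / 2" q] by (simp add: B_def C2_def algebra_simps)
    ultimately have "C2 * m R powr \<beta> * R powr q \<le> m (R / 2)" using m by linarith
    also have "m (R / 2) \<le> 2 powr \<theta> * m R"
    proof -
      have "m (R / 2) * (R powr \<theta> / 2 powr \<theta>) \<le> m R * R powr \<theta>"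
        using h_mono[of "R / 2" R] R by (simp add: h_def powr_divide)
      then have "R powr \<theta> * m (R / 2) \<le> R powr \<theta> * (2 powr \<theta> * m R)"
        by (simp add: field_simps)
      then show ?thesis using R by (subst (asm) mult_le_cancel_left_pos) auto
    qed
    also have "m R powr \<beta> = m R powr (\<beta> - 1) * m R"
      using m powr_add[of "m R" "\<beta> - 1" 1] by simp
    finally have "m R * (C2 * (m R powr (\<beta> - 1) * R powr q)) \<le> m R * 2 powr \<theta>"
      by (simp add: mult_ac)
    then have "m R powr (\<beta> - 1) * R powr q \<le> 2 powr \<theta> / C2"
      using m C2 by (simp add: pos_le_divide_eq mult.commute)
    moreover have "m R powr (\<beta> - 1) * R powr q = h R powr (\<beta> - 1)"
      using m R theta_ratio by (simp add: h_def powr_mult powr_powr \<beta>_def q_def)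
    ultimately have "(h R powr (\<beta> - 1)) powr (1 / (\<beta> - 1)) \<le> (2 powr \<theta> / C2) powr (1 / (\<beta> - 1))"
      using \<beta> by (intro powr_mono2) auto
    then show ?thesis using \<beta> h_pos[OF R] by (simp add: powr_powr)
  qed
  then show ?thesis by blast
qed

text \<open>
  Comparison with \<open>v = M (R\<^sup>-\<^sup>t - |x - y|\<^sup>-\<^sup>t)\<close> for \<open>t = \<theta> - \<delta>/d\<close> on \<open>r \<le> |x - y| \<le> R = L\<^sup>2 r\<close>.
  Here \<open>F[v]\<close> is \<open>\<kappa> \<delta> (M t)\<^sup>d\<close> times \<open>|x - y|\<^sup>\<delta>\<^sup>-\<^sup>n\<close>; since \<open>L powr (2 \<delta>) = 2\<close>, the factor
  \<open>(|x - y|/r)\<^sup>\<delta>\<close> is at most \<open>2\<close> on the annulus, and a small \<open>\<delta>\<close> keeps \<open>F[v]\<close> below \<open>c (-u)\<^sup>k\<^sup>s\<close>,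
  which is at least \<open>c h(r)\<^sup>k\<^sup>s |x - y|\<^sup>-\<^sup>n\<close>. At the radius \<open>L r\<close> the slower decay has gained the
  factor \<open>L powr (\<delta>/d) = 2 powr (1/(2 d))\<close>, independent of \<open>\<delta>\<close>, whereas the loss caused by the
  boundary condition at \<open>R\<close> tends to \<open>0\<close> with \<open>\<delta>\<close>.
\<close>
lemma h_growth: "\<exists>L \<eta>. L \<ge> 1 \<and> \<eta> > 0 \<and> (\<forall>r\<ge>1. (1 + \<eta>) * h r \<le> h (L * r))"
proof -
  \<comment> \<open>Half of the gain; the other half absorbs the loss.\<close>
  define \<eta> where "\<eta> = ((2::real) powr (1 / (2 * d)) - 1) / 2"
  have "(2::real) powr 0 < 2 powr (1 / (2 * d))" using d_pos by (intro powr_less_mono) auto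
  then have \<eta>: "\<eta> > 0" by (simp add: \<eta>_def)
  have h1: "h 1 > 0" using h_pos by simp
  have "filterlim (\<lambda>\<delta>. \<theta> / 2 * inverse \<delta>) at_top (at_right 0)"
    using theta_pos by (intro filterlim_tendsto_pos_mult_at_top[OF tendsto_const] filterlim_inverse_at_top_right) auto
  then have "\<forall>\<^sub>F \<delta> in at_right 0. 1 / d - log 2 \<eta> < \<theta> / 2 * inverse \<delta>"
    by (simp only: filterlim_at_top_dense)
  moreover have "((\<lambda>\<delta>. 2 * \<kappa> * \<delta> * \<theta> powr d) \<longlongrightarrow> 2 * \<kappa> * 0 * \<theta> powr d) (at_right 0)"
    by (intro tendsto_intros)
  then have "\<forall>\<^sub>F \<delta> in at_right 0. 2 * \<kappa> * \<delta> * \<theta> powr d < c * h 1 powr (ks - d)"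
    by (rule order_tendstoD) (use c h1 in auto)
  moreover have "((\<lambda>\<delta>. \<delta> / d) \<longlongrightarrow> 0 / d) (at_right 0)"
    by (intro tendsto_intros) (use d_pos in auto)
  then have "\<forall>\<^sub>F \<delta> in at_right 0. \<delta> / d < \<theta>"
    by (rule order_tendstoD) (use theta_pos in auto)
  moreover have "\<forall>\<^sub>F \<delta> in at_right 0. \<delta> > (0::real)"
    by (simp add: eventually_at_right_less)
  ultimately have "\<forall>\<^sub>F \<delta> in at_right 0. 1 / d - log 2 \<eta> < \<theta> / 2 * inverse \<delta> \<and>
      2 * \<kappa> * \<delta> * \<theta> powr d < c * h 1 powr (ks - d) \<and> \<delta> / d < \<theta> \<and> \<delta> > 0"
    by eventually_elim simp
  \<comment> \<open>In this order: the loss is at most \<open>\<eta>\<close>; \<open>F[v]\<close> is small enough, already for \<open>r = 1\<close> and hence for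
    \<open>r \<ge> 1\<close>, as \<open>ks > d\<close> and \<open>h\<close> is nondecreasing; the exponent \<open>t\<close> is positive.\<close>
  then obtain \<delta> where \<delta>: "1 / d - log 2 \<eta> < \<theta> / 2 * inverse \<delta>"
      "2 * \<kappa> * \<delta> * \<theta> powr d < c * h 1 powr (ks - d)" "\<delta> / d < \<theta>" "\<delta> > 0"
    using eventually_happens by fastforce
  define t where "t = \<theta> - \<delta> / d"
  define L where "L = (2::real) powr (1 / (2 * \<delta>))"
  have t: "0 < t" "t < \<theta>" using \<delta> d_pos by (auto simp: t_def)
  have "(2::real) powr 0 < 2 powr (1 / (2 * \<delta>))" using \<delta> by (intro powr_less_mono) auto
  then have L: "L > 1" by (simp add: L_def)
  have LL: "(L * L) powr \<delta> = 2"
    using \<delta> by (simp add: L_def powr_powr flip: powr_add)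
  have L_eta: "1 + \<eta> \<le> L powr \<theta> * (L powr (- t) - (L * L) powr (- t))"
  proof -
    have "L powr \<theta> * L powr (- t) = 1 + 2 * \<eta>"
      using \<delta> d_pos by (simp add: L_def t_def powr_powr \<eta>_def field_simps flip: powr_add)
    moreover have "L powr \<theta> * (L * L) powr (- t) \<le> \<eta>"
    proof -
      have "L powr \<theta> * (L * L) powr (- t) = L powr (\<theta> - t - t)"
        using L by (simp add: powr_mult flip: powr_add)
      also have "\<dots> = 2 powr (1 / d - \<theta> / 2 * inverse \<delta>)"
        using \<delta> d_pos by (simp add: L_def powr_powr t_def field_simps)
      also have "\<dots> \<le> 2 powr (log 2 \<eta>)" using \<delta> by (intro powr_mono) auto
      also have "\<dots> = \<eta>" using \<eta> by simp
      finally show ?thesis .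
    qed
    ultimately show ?thesis by (simp add: right_diff_distrib)
  qed
  have "(1 + \<eta>) * h r \<le> h (L * r)" if r: "r \<ge> 1" for r
  proof -
    have r0: "r > 0" using r by simp
    have m: "m r > 0" using m_pos r by simp
    define M where "M = m r * r powr t"
    define R where "R = L * L * r"
    have M: "M > 0" using m r0 by (simp add: M_def)
    have Mr: "M * r powr (- t) = m r" using r0 by (simp add: M_def powr_minus)
    have R0: "R > 0" using L r0 by (simp add: R_def)
    have bound: "M * (norm (x - y) powr (- t) - R powr (- t)) \<le> - u x"
      if x: "r \<le> norm (x - y)" "norm (x - y) \<le> R" for x
    proof -
      have "u x \<le> M * R powr (- t) + (- M) * norm (x - y) powr (- t)"
      proof (rule comparison_radial_power[OF adm k k_le p, where q = "- t" and R = R and ?r0.0 = r])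
        show "(- M) * (- t) > 0" using M t by simp
        show "- t \<le> p / (p - 1)" using t p'_gt_1 by linarith
        show "u z \<le> M * R powr - t + - M * r powr - t \<or> r = 0 \<and> 1 < - t \<and> grad u z \<noteq> 0"
          if "norm (z - y) = r" for z
        proof -
          have "M * R powr - t \<ge> 0" using M by simp
          then show ?thesis using m_le[of z r] that Mr by simp
        qed
        show "u z \<le> M * R powr - t + - M * R powr - t" for z
          using neg[of z] by simp
        show "radial_hessian CARD('n) k p (- M) (- t) (norm (z - y)) < p_k_Hessian k p u z"
          if z: "r < norm (z - y)" "norm (z - y) < R"
            and gt: "M * R powr - t + - M * norm (z - y) powr - t < u z" for z
        proof -
          define s where "s = norm (z - y)"
          have s: "0 < s" "r < s" "s < R" using z r0 by (auto simp: s_def)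
          have "- u z < M * s powr - t - M * R powr - t" using gt by (simp add: s_def)
          also have "\<dots> \<le> M * s powr - t" using M by simp
          also have "\<dots> \<le> M * r powr - t"
            using M s r0 t by (intro mult_left_mono powr_mono2') auto
          also have "\<dots> \<le> - u y" using m_le_center[of r] r0 by (simp add: Mr)
          also have "\<dots> \<le> 2 * (- u y)" using neg[of y] by simp
          finally have "c * (- u z) powr ks \<le> p_k_Hessian k p u z" by (rule crit)
          moreover have "h r powr ks * s powr (- n) \<le> (- u z) powr ks"
          proof -
            have "(h r * s powr (- \<theta>)) powr ks \<le> (- u z) powr ks"
              using lower_bound_fundamental[of r z] r0 z h_pos[OF r0] ks_gt d_pos
              by (intro powr_mono2) (auto simp: s_def)
            then show ?thesis
              using h_pos[OF r0] by (simp add: powr_mult powr_powr theta_ks)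
          qed
          then have "c * (h r powr ks * s powr (- n)) \<le> c * (- u z) powr ks" using c by simp
          moreover have "radial_hessian CARD('n) k p (- M) (- t) s < c * (h r powr ks * s powr (- n))"
          proof -
            have "real k * ((- t - 1) * (p - 1) - 1) = \<delta> - n"
              using fundamental_exponent[of t] d_pos by (simp add: t_def algebra_simps)
            moreover have "n - real k + real k * ((- t - 1) * (p - 1)) = \<delta>"
              unfolding fundamental_exponent using d_pos by (simp add: t_def)
            ultimately have "radial_hessian CARD('n) k p (- M) (- t) s
                = \<kappa> * \<delta> * (M * t) powr d * s powr (\<delta> - n)"
              unfolding radial_hessian_def n[symmetric] \<kappa>[symmetric] d_def by simp
            also have "(M * t) powr d = h r powr d * r powr (- \<delta>) * t powr d"
            proof -
              have "M = h r * r powr (- \<delta> / d)"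
                using r0 by (simp add: M_def h_def t_def mult.assoc flip: powr_add)
              then show ?thesis using h_pos[OF r0] t d_pos by (simp add: powr_mult powr_powr)
            qed
            also have "s powr (\<delta> - n) = s powr \<delta> * s powr (- n)"
              by (simp flip: powr_add)
            finally have eq: "radial_hessian CARD('n) k p (- M) (- t) s =
                (\<kappa> * \<delta>) * (t powr d * (s powr \<delta> * r powr (- \<delta>))) * (h r powr d * s powr (- n))"
              by (simp add: mult_ac)
            have sr: "s powr \<delta> * r powr (- \<delta>) \<le> 2"
            proof -
              have "s powr \<delta> \<le> R powr \<delta>" using s \<delta> by (intro powr_mono2) auto
              also have "R powr \<delta> = 2 * r powr \<delta>"
                using L r0 LL unfolding R_def by (subst powr_mult) auto
              finally have "s powr \<delta> * r powr (- \<delta>) \<le> 2 * r powr \<delta> * r powr (- \<delta>)"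
                by (intro mult_right_mono) auto
              also have "\<dots> = 2" using r0 by (simp add: powr_minus)
              finally show ?thesis .
            qed
            have "t powr d \<le> \<theta> powr d" using t d_pos by (intro powr_mono2) auto
            then have "t powr d * (s powr \<delta> * r powr (- \<delta>)) \<le> \<theta> powr d * 2"
              using sr by (intro mult_mono) auto
            then have "(\<kappa> * \<delta>) * (t powr d * (s powr \<delta> * r powr (- \<delta>))) \<le> (\<kappa> * \<delta>) * (\<theta> powr d * 2)"
              using kappa_pos \<delta> by (intro mult_left_mono) auto
            also have "\<dots> < c * h 1 powr (ks - d)" using \<delta>(2) by (simp add: mult_ac)
            also have "\<dots> \<le> c * h r powr (ks - d)"
              using h_mono[of 1 r] r h1 ks_gt c by (intro mult_left_mono powr_mono2) auto
            finally have "radial_hessian CARD('n) k p (- M) (- t) s <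
                c * h r powr (ks - d) * (h r powr d * s powr (- n))"
              unfolding eq using h_pos[OF r0] s by (intro mult_strict_right_mono) auto
            also have "\<dots> = c * (h r powr ks * s powr (- n))"
              using powr_add[of "h r" "ks - d" d] by simp
            finally show ?thesis .
          qed
          ultimately show ?thesis by (simp add: s_def)
        qed
      qed (use r0 x in auto)
      then show ?thesis by (simp add: algebra_simps)
    qed
    have "M * ((L * r) powr (- t) - R powr (- t)) \<le> m (L * r)"
    proof (rule m_ge)
      fix x assume x: "norm (x - y) \<le> L * r"
      show "M * ((L * r) powr (- t) - R powr (- t)) \<le> - u x"
      proof (cases "norm (x - y) \<le> r")
        case True
        have "(L * r) powr (- t) \<le> r powr (- t)" using L r0 t by (intro powr_mono2') auto
        then have "M * ((L * r) powr (- t) - R powr (- t)) \<le> M * r powr (- t)"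
          using M by (intro mult_left_mono) (auto intro: order.trans[OF _ \<open>_ \<le> r powr _\<close>])
        then show ?thesis using m_le[OF True] by (simp add: Mr)
      next
        case False
        have "L * r * 1 \<le> L * r * L" using L r0 by (intro mult_left_mono) auto
        then have "norm (x - y) \<le> R" using x by (simp add: R_def mult_ac)
        moreover have "(L * r) powr (- t) \<le> norm (x - y) powr (- t)"
          using False x r0 t by (intro powr_mono2') auto
        then have "M * ((L * r) powr (- t) - R powr (- t)) \<le> M * (norm (x - y) powr (- t) - R powr (- t))"
          using M by (intro mult_left_mono diff_right_mono) auto
        ultimately show ?thesis using bound[of x] False by simp
      qed
    qed (use L r0 in auto)
    then have "M * ((L * r) powr (- t) - R powr (- t)) * (L * r) powr \<theta> \<le> h (L * r)"
      unfolding h_def[of "L * r"] by (intro mult_right_mono) auto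
    moreover have "M * ((L * r) powr (- t) - R powr (- t)) * (L * r) powr \<theta>
        = h r * (L powr \<theta> * (L powr (- t) - (L * L) powr (- t)))"
    proof -
      have "M * ((L * r) powr (- t) - R powr (- t)) = M * r powr (- t) * (L powr (- t) - (L * L) powr (- t))"
        using L r0 unfolding R_def by (subst (1 2) powr_mult) (auto simp: algebra_simps)
      moreover have "(L * r) powr \<theta> = L powr \<theta> * r powr \<theta>" by (rule powr_mult)
      ultimately show ?thesis by (simp add: Mr h_def mult_ac)
    qed
    moreover have "h r * (1 + \<eta>) \<le> h r * (L powr \<theta> * (L powr (- t) - (L * L) powr (- t)))"
      using h_pos[OF r0] L_eta by (intro mult_left_mono) auto
    ultimately show ?thesis by (simp add: mult.commute)
  qed
  then show ?thesis using L \<eta> by (intro exI[of _ L] exI[of _ \<eta>]) auto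
qed

lemma no_entire_subsolution: False
proof -
  obtain H where H: "\<And>R. R > 0 \<Longrightarrow> h R \<le> H" using h_bounded by blast
  obtain L \<eta> where L: "L \<ge> 1" "\<eta> > 0" "\<And>r. r \<ge> 1 \<Longrightarrow> (1 + \<eta>) * h r \<le> h (L * r)"
    using h_growth by blast
  define s where "s = (SUP r\<in>{1..}. h r)"
  have bdd: "bdd_above (h ` {1..})" using H by (intro bdd_aboveI2[of _ _ H]) auto
  have "h r \<le> s / (1 + \<eta>)" if r: "r \<ge> 1" for r
  proof -
    have "1 * 1 \<le> L * r" using L r by (intro mult_mono) auto
    then have "h (L * r) \<le> s" unfolding s_def using bdd by (intro cSUP_upper) auto
    then have "(1 + \<eta>) * h r \<le> s" using L(3)[OF r] by simp
    then show ?thesis using L by (simp add: pos_le_divide_eq mult.commute)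
  qed
  then have "s \<le> s / (1 + \<eta>)" unfolding s_def by (intro cSUP_least) auto
  moreover have "h 1 \<le> s" unfolding s_def using bdd by (intro cSUP_upper) auto
  then have "s > 0" using h_pos[of 1] by simp
  ultimately show False using L by (simp add: pos_le_divide_eq)
qed

end

text \<open>
  Where \<open>-u < 2 (-u(y))\<close>, the factor \<open>(-u)\<^sup>\<alpha>\<^sup>-\<^sup>k\<^sup>s\<close> is bounded below, its exponent being
  nonpositive.
\<close>
theorem no_negative_solution:
  fixes u :: "real ^ 'n \<Rightarrow> real"
  assumes k: "1 \<le> k" and p: "1 < p" and pk: "p * real k < real CARD('n)"
    and u: "u \<in> admissible p k UNIV" and neg: "\<And>x. u x < 0"
    and ineq: "\<And>x. p_k_Hessian k p u x \<ge> (- u x) powr \<alpha>"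
  shows "\<alpha> > k_star CARD('n) k p"
proof (rule ccontr)
  assume "\<not> ?thesis"
  then have \<alpha>: "\<alpha> \<le> k_star CARD('n) k p" by simp
  have pos: "p_k_Hessian k p u x > 0" for x
    using ineq[of x] neg[of x] by (metis less_le_trans neg_0_less_iff_less powr_gt_zero less_irrefl)
  obtain y where y: "grad u y \<noteq> 0"
    using exists_grad_nonzero[OF k] pos by (metis less_irrefl)
  define c where "c = (2 * (- u y)) powr (\<alpha> - k_star CARD('n) k p)"
  interpret entire_subsolution u y k p c "real CARD('n)" "k_star CARD('n) k p" "hessian_const CARD('n) k"
  proof
    show "c > 0" using neg[of y] by (simp add: c_def)
    show "c * (- u x) powr k_star CARD('n) k p \<le> p_k_Hessian k p u x" if "- u x < 2 * (- u y)" for x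
    proof -
      have "c \<le> (- u x) powr (\<alpha> - k_star CARD('n) k p)"
        unfolding c_def using \<alpha> neg[of x] that by (intro powr_mono2') auto
      then have "c * (- u x) powr k_star CARD('n) k p
          \<le> (- u x) powr (\<alpha> - k_star CARD('n) k p) * (- u x) powr k_star CARD('n) k p"
        by (intro mult_right_mono) auto
      also have "\<dots> = (- u x) powr \<alpha>" by (simp flip: powr_add)
      finally show ?thesis using ineq[of x] by simp
    qed
  qed (use assms pos y in auto)
  show False by (rule no_entire_subsolution)
qed

section \<open>Existence above the critical exponent\<close>

lemma continuous_norm_powr_scaleR:
  assumes "q > 1"
  shows "continuous_on UNIV (\<lambda>x::'a::real_inner. norm x powr (q - 2) *\<^sub>R x)"
proof -
  let ?P = "\<lambda>x::'a. norm x powr (q - 2) *\<^sub>R x"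
  have "isCont ?P x" for x
  proof (cases "x = 0")
    case False
    then show ?thesis
      using has_derivative_continuous[OF has_derivative_norm_powr_scaleR[of x "q - 2"]] by simp
  next
    case True
    have "norm (?P y) = norm y powr (q - 1)" for y
      using powr_add[of "norm y" "q - 2" 1] by (cases "y = 0") auto
    moreover have "((\<lambda>y::'a. norm y powr (q - 1)) \<longlongrightarrow> norm (0::'a) powr (q - 1)) (at 0)"
      using assms by (intro tendsto_powr' tendsto_intros) auto
    ultimately have "((\<lambda>y. norm (?P y)) \<longlongrightarrow> 0) (at 0)" by simp
    then have "(?P \<longlongrightarrow> 0) (at 0)" by (rule tendsto_norm_zero_cancel)
    then show ?thesis using True by (simp add: isCont_def)
  qed
  then show ?thesis by (simp add: continuous_at_imp_continuous_on)
qed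

locale radial_profile =
  fixes p s \<epsilon> q :: real
  assumes p: "1 < p" and s: "s > 0" and \<epsilon>: "\<epsilon> > 0" and q: "q = p / (p - 1)"
begin

definition profile :: "real ^ 'n \<Rightarrow> real" where
  "profile x = - \<epsilon> * (1 + norm x powr q) powr (- s)"

lemma q_gt_1: "q > 1"
  using p by (simp add: q)

lemma qp: "(q - 1) * (p - 1) = 1"
  using p by (simp add: q field_simps)

lemma base_pos: "1 + norm x powr q > 0"
  by (smt (verit) powr_ge_zero)

lemma base_powr_has_derivative:
  fixes x :: "real ^ 'n"
  shows "((\<lambda>x. (1 + norm x powr q) powr t) has_derivative
    (\<lambda>h. t * (1 + norm x powr q) powr (t - 1) * (q * norm x powr (q - 2) * (x \<bullet> h)))) (at x)"
proof -
  have "((\<lambda>y. y powr t) has_derivative (\<lambda>h. t * (1 + norm x powr q) powr (t - 1) * h)) (at (1 + norm x powr q))"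
    using has_real_derivative_powr[OF base_pos] by (simp add: has_field_derivative_def)
  moreover have "((\<lambda>x. 1 + norm x powr q) has_derivative (\<lambda>h. q * norm x powr (q - 2) * (x \<bullet> h))) (at x)"
    using has_derivative_add[OF has_derivative_const has_derivative_norm_powr_at_any[of x q], of 1] q_gt_1 by simp
  ultimately show ?thesis by (rule has_derivative_compose[rotated])
qed

lemma profile_has_derivative:
  "(profile has_derivative (\<lambda>h.
    ((\<epsilon> * s * q * (1 + norm x powr q) powr (- s - 1)) *\<^sub>R (norm x powr (q - 2) *\<^sub>R x)) \<bullet> h)) (at x)"
  unfolding profile_def
  by (rule has_derivative_eq_rhs[OF has_derivative_mult_right[OF base_powr_has_derivative]])
     (simp add: mult_ac)

lemma continuous_base_powr: "continuous_on UNIV (\<lambda>x::real ^ 'n. (1 + norm x powr q) powr t)"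
  using base_powr_has_derivative has_derivative_continuous
  by (intro continuous_at_imp_continuous_on ballI) blast

lemma grad_profile:
  "grad profile x = (\<epsilon> * s * q * (1 + norm x powr q) powr (- s - 1)) *\<^sub>R (norm x powr (q - 2) *\<^sub>R x)"
  by (rule grad_eqI) (rule profile_has_derivative)

lemma C1_profile: "C1_on (profile :: real ^ 'n \<Rightarrow> real) UNIV"
  unfolding C1_on_def
proof (intro exI conjI ballI)
  let ?G = "\<lambda>x::real ^ 'n. (\<epsilon> * s * q * (1 + norm x powr q) powr (- s - 1)) *\<^sub>R (norm x powr (q - 2) *\<^sub>R x)"
  show "(profile has_derivative blinfun_apply (blinfun_inner_right (?G x))) (at x)" for x
    by (simp only: blinfun_inner_right.rep_eq) (rule profile_has_derivative)
  have "continuous_on UNIV ?G"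
    by (intro continuous_on_scaleR[OF _ continuous_norm_powr_scaleR[OF q_gt_1]]
        continuous_on_mult_left continuous_base_powr)
  then show "continuous_on UNIV (\<lambda>x. blinfun_inner_right (?G x))"
    by (rule bounded_linear.continuous_on[OF bounded_linear_blinfun_inner_right])
qed

definition "C = (\<epsilon> * s * q) powr (p - 1)"
definition "N = (s + 1) * (p - 1)"

lemma C_pos: "C > 0"
  using \<epsilon> s q_gt_1 by (simp add: C_def)

text \<open>
  The choice \<open>q = p/(p-1)\<close> makes the powers of \<open>|x|\<close> cancel, so that the field is a smooth
  function of \<open>|x|\<^sup>q\<close> times \<open>x\<close>; as \<open>q > 1\<close>, it is \<open>C\<^sup>1\<close> also at the origin.
\<close>
lemma p_field_profile: "p_field p profile x = (C * (1 + norm x powr q) powr (- N)) *\<^sub>R x"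
proof (cases "x = 0")
  case False
  define r where "r = norm x"
  define a where "a = \<epsilon> * s * q * (1 + r powr q) powr (- s - 1)"
  have r: "r > 0" using False by (simp add: r_def)
  have b: "1 + r powr q > 0" by (simp add: r_def base_pos)
  have e: "\<epsilon> * s * q > 0" using \<epsilon> s q_gt_1 by simp
  have a: "a > 0" unfolding a_def using e b by simp
  have g: "grad profile x = (a * r powr (q - 2)) *\<^sub>R x"
    by (simp add: grad_profile a_def r_def)
  have "norm (grad profile x) = a * (r powr (q - 2) * r)"
    using a by (simp add: g r_def)
  also have "r powr (q - 2) * r = r powr (q - 1)"
    using powr_add[of r "q - 2" 1] r by simp
  finally have "norm (grad profile x) powr (p - 2) = a powr (p - 2) * r powr ((q - 1) * (p - 2))"
    using a by (simp add: powr_mult powr_powr)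
  then have "p_field p profile x =
      (a powr (p - 2) * a * (r powr ((q - 1) * (p - 2)) * r powr (q - 2))) *\<^sub>R x"
    by (simp add: p_field_def g mult_ac)
  also have "(q - 1) * (p - 2) + (q - 2) = 0" using qp by (simp add: algebra_simps)
  then have "r powr ((q - 1) * (p - 2)) * r powr (q - 2) = 1"
    using r by (simp flip: powr_add)
  also have "a powr (p - 2) * a = a powr (p - 1)" using powr_add[of a "p - 2" 1] a by simp
  also have "a powr (p - 1) = C * (1 + r powr q) powr (- N)"
    unfolding a_def using e b by (simp add: powr_mult powr_powr C_def N_def algebra_simps)
  finally show ?thesis by (simp add: r_def)
qed (simp add: p_field_def grad_profile)

lemma p_field_profile_has_derivative:
  fixes x :: "real ^ 'n"
  shows "(p_field p profile has_derivative
    (\<lambda>h. (C * (1 + norm x powr q) powr (- N)) *\<^sub>R h +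
      (- C * N * q * (1 + norm x powr q) powr (- N - 1) * ((norm x powr (q - 2) *\<^sub>R x) \<bullet> h)) *\<^sub>R x)) (at x)"
proof -
  have eq: "p_field p profile = (\<lambda>x::real ^ 'n. (C * (1 + norm x powr q) powr (- N)) *\<^sub>R x)"
    by (rule ext) (rule p_field_profile)
  show ?thesis
    unfolding eq
    by (rule has_derivative_eq_rhs[OF has_derivative_scaleR[OF has_derivative_mult_right[OF
            base_powr_has_derivative] has_derivative_ident]]) (simp add: mult_ac)
qed

lemma C1_p_field_profile: "C1_on (p_field p profile :: real ^ 'n \<Rightarrow> real ^ 'n) UNIV"
  unfolding C1_on_def
proof (intro exI conjI ballI)
  let ?D = "\<lambda>x h::real ^ 'n. (C * (1 + norm x powr q) powr (- N)) *\<^sub>R h +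
      (- C * N * q * (1 + norm x powr q) powr (- N - 1) * ((norm x powr (q - 2) *\<^sub>R x) \<bullet> h)) *\<^sub>R x"
  have D: "blinfun_apply (Blinfun (?D x)) = ?D x" for x
    by (rule bounded_linear_Blinfun_apply) (rule has_derivative_bounded_linear[OF p_field_profile_has_derivative])
  show "(p_field p profile has_derivative blinfun_apply (Blinfun (?D x))) (at x)" for x
    unfolding D by (rule p_field_profile_has_derivative)
  show "continuous_on UNIV (\<lambda>x. Blinfun (?D x))"
    by (rule continuous_on_blinfun_componentwise, unfold D)
       (intro continuous_intros continuous_base_powr continuous_norm_powr_scaleR[OF q_gt_1])
qed

text \<open>
  The Jacobian is \<open>b I + c x x\<^sup>T\<close>. Its radial eigenvalue is \<open>b (1 - N q \<zeta>)\<close> with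
  \<open>N q = (s + 1) p\<close>, where \<open>\<zeta> = |x|\<^sup>q / (1 + |x|\<^sup>q)\<close> increases from \<open>0\<close> to \<open>1\<close>.
\<close>
lemma eigvals_profile:
  fixes x :: "real ^ 'n"
  obtains \<mu> :: "real ^ 'n" where "eigvals (p_jacobian p profile x) = (\<chi> i. complex_of_real (\<mu> $ i))"
    "\<And>l. Suc l \<le> CARD('n) \<Longrightarrow> elem_sym (Suc l) \<mu> = hessian_const CARD('n) (Suc l) *
      (C * (1 + norm x powr q) powr (- N)) ^ Suc l *
      (real CARD('n) - real (Suc l) * (s + 1) * p * (norm x powr q / (1 + norm x powr q)))"
proof -
  define b where "b = C * (1 + norm x powr q) powr (- N)"
  define c where "c = - C * N * q * (1 + norm x powr q) powr (- N - 1) * norm x powr (q - 2)"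
  define \<zeta> where "\<zeta> = norm x powr q / (1 + norm x powr q)"
  define A where "A = p_jacobian p profile x"
  have "p_field p (profile :: real ^ 'n \<Rightarrow> real) differentiable (at x)"
    using C1_on_differentiable[OF C1_p_field_profile] by blast
  then have "(p_field p profile has_derivative (\<lambda>h. A *v h)) (at x)"
    unfolding A_def p_jacobian_def by (simp flip: jacobian_works)
  from has_derivative_unique[OF this p_field_profile_has_derivative]
  have A: "A *v h = b *\<^sub>R h + (c * (x \<bullet> h)) *\<^sub>R x" for h
    by (simp add: fun_eq_iff b_def c_def mult_ac)
  obtain \<mu> where \<mu>: "eigvals A = (\<chi> i. complex_of_real (\<mu> $ i))"
    "\<And>l. elem_sym (Suc l) \<mu> = real (CARD('n) - 1 choose Suc l) * b ^ Suc l
       + real (CARD('n) - 1 choose l) * (b + c * (norm x)\<^sup>2) * b ^ l"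
    using eigvals_scalar_plus_rank_one[OF A] by blast
  have "norm x powr (q - 2) * (norm x)\<^sup>2 = norm x powr q"
    using powr_add[of "norm x" "q - 2" 2] by (cases "x = 0") auto
  moreover have "(1 + norm x powr q) powr (- N - 1) = (1 + norm x powr q) powr (- N) / (1 + norm x powr q)"
    using base_pos[of x] by (simp add: powr_diff)
  ultimately have c: "b + c * (norm x)\<^sup>2 = b * (1 - N * q * \<zeta>)"
    by (simp add: b_def c_def \<zeta>_def right_diff_distrib mult.assoc)
  have Nq: "N * q = (s + 1) * p" using p by (simp add: N_def q)
  have "elem_sym (Suc l) \<mu> = hessian_const CARD('n) (Suc l) * b ^ Suc l *
      (real CARD('n) - real (Suc l) * (s + 1) * p * \<zeta>)" if "Suc l \<le> CARD('n)" for l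
  proof -
    have "elem_sym (Suc l) \<mu> = b ^ Suc l * (real (CARD('n) - 1 choose Suc l)
        + real (CARD('n) - 1 choose l) * (1 - N * q * \<zeta>))"
      unfolding \<mu>(2) c by (simp add: algebra_simps)
    then show ?thesis
      unfolding binomial_hessian_const[OF that] Nq by (simp add: algebra_simps)
  qed
  with \<mu>(1) show ?thesis using that[of \<mu>] by (simp add: A_def b_def \<zeta>_def)
qed

end

lemma exists_negative_solution:
  fixes k :: nat and p \<alpha> :: real
  assumes k: "1 \<le> k" "k \<le> CARD('n::finite)" and p: "1 < p" and pk: "p * real k < real CARD('n)"
    and \<alpha>: "\<alpha> > k_star CARD('n) k p"
  shows "\<exists>u \<in> admissible p k (UNIV :: (real ^ 'n) set).
    (\<forall>x. u x < 0) \<and> (\<forall>x. p_k_Hessian k p u x \<ge> (- u x) powr \<alpha>)"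
proof -
  define n where "n = real CARD('n)"
  define \<kappa> where "\<kappa> = hessian_const CARD('n) k"
  define d where "d = real k * (p - 1)"
  define q where "q = p / (p - 1)"
  have d: "d > 0" using k p by (simp add: d_def)
  have \<kappa>: "\<kappa> > 0" using hessian_const_pos[OF k] by (simp add: \<kappa>_def)
  have q: "q > 0" using p by (simp add: q_def)
  have ks: "k_star CARD('n) k p = n * d / (n - p * real k)"
    by (simp add: k_star_def d_def n_def mult_ac)
  have n_pk: "n - p * real k > 0" using pk by (simp add: n_def)
  have \<alpha>n: "n * d < \<alpha> * (n - p * real k)"
    using \<alpha> n_pk unfolding ks by (simp add: pos_divide_less_eq)
  have "d * (n - p * real k) < d * n" using d k p by (intro mult_strict_left_mono) auto
  then have "d * (n - p * real k) < \<alpha> * (n - p * real k)" using \<alpha>n by (simp add: mult.commute)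
  then have \<alpha>d: "\<alpha> > d" using n_pk by simp
  \<comment> \<open>With this \<open>s\<close> both sides of the inequality decay at the same rate.\<close>
  define s where "s = d / (\<alpha> - d)"
  have s: "s > 0" using d \<alpha>d by (simp add: s_def)
  have s\<alpha>: "s * \<alpha> = (s + 1) * d" using \<alpha>d by (simp add: s_def field_simps)
  define \<nu> where "\<nu> = n - real k * (s + 1) * p"
  have \<nu>: "\<nu> > 0"
  proof -
    have "s + 1 = \<alpha> / (\<alpha> - d)" using \<alpha>d by (simp add: s_def field_simps)
    moreover have "real k * \<alpha> * p < n * (\<alpha> - d)" using \<alpha>n by (simp add: algebra_simps)
    ultimately show ?thesis using \<alpha>d by (simp add: \<nu>_def pos_divide_less_eq)
  qed
  \<comment> \<open>This \<open>\<epsilon>\<close> balances the degrees of homogeneity \<open>d < \<alpha>\<close> of the two sides.\<close>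
  define \<epsilon> where "\<epsilon> = (\<kappa> * \<nu> * (s * q) powr d) powr (1 / (\<alpha> - d))"
  have e: "\<kappa> * \<nu> * (s * q) powr d > 0" using \<kappa> \<nu> s q by simp
  then have \<epsilon>: "\<epsilon> > 0" unfolding \<epsilon>_def by (simp only: powr_gt_zero)
  have \<epsilon>\<alpha>: "\<epsilon> powr \<alpha> = \<kappa> * \<nu> * (\<epsilon> * s * q) powr d"
  proof -
    have "\<epsilon> powr \<alpha> = \<epsilon> powr (\<alpha> - d) * \<epsilon> powr d" by (simp flip: powr_add)
    also have "\<epsilon> powr (\<alpha> - d) = \<kappa> * \<nu> * (s * q) powr d"
      unfolding \<epsilon>_def using e \<alpha>d by (simp add: powr_powr)
    finally show ?thesis using \<epsilon> s q by (simp add: powr_mult mult_ac)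
  qed
  interpret radial_profile p s \<epsilon> q
    by standard (use p s \<epsilon> q_def in auto)
  define u where "u = (profile :: real ^ 'n \<Rightarrow> real)"
  have main: "eigvals_in (p_jacobian p u x) (Gamma_cone k) \<and> p_k_Hessian k p u x \<ge> (- u x) powr \<alpha>" for x
  proof -
    define z where "z = 1 + norm x powr q"
    define b where "b = C * z powr (- N)"
    define \<zeta> where "\<zeta> = norm x powr q / (1 + norm x powr q)"
    have z: "z > 0" by (simp add: z_def base_pos)
    have b: "b > 0" using C_pos z by (simp add: b_def)
    have \<zeta>: "0 \<le> \<zeta>" "\<zeta> \<le> 1" using base_pos[of x] by (auto simp: \<zeta>_def)
    obtain \<mu> :: "real ^ 'n" where \<mu>: "eigvals (p_jacobian p u x) = (\<chi> i. complex_of_real (\<mu> $ i))"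
      "\<And>l. Suc l \<le> CARD('n) \<Longrightarrow> elem_sym (Suc l) \<mu> = hessian_const CARD('n) (Suc l) *
        b ^ Suc l * (n - real (Suc l) * (s + 1) * p * \<zeta>)"
      using eigvals_profile[of x] unfolding u_def b_def z_def \<zeta>_def n_def by blast
    have ge: "elem_sym l \<mu> \<ge> hessian_const CARD('n) l * b ^ l * \<nu>" if l: "1 \<le> l" "l \<le> k" for l
    proof -
      have "real l * ((s + 1) * p * \<zeta>) \<le> real k * ((s + 1) * p * 1)"
        using l s p \<zeta> by (intro mult_mono mult_left_mono) auto
      then have "\<nu> \<le> n - real l * (s + 1) * p * \<zeta>" by (simp add: \<nu>_def mult_ac)
      then have "hessian_const CARD('n) l * b ^ l * \<nu> \<le>
          hessian_const CARD('n) l * b ^ l * (n - real l * (s + 1) * p * \<zeta>)"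
        using hessian_const_pos[of l "CARD('n)"] l k b by (intro mult_left_mono) auto
      then show ?thesis using \<mu>(2)[of "l - 1"] l k by simp
    qed
    have "\<mu> \<in> Gamma_cone k"
    proof -
      have "elem_sym l \<mu> \<ge> 0" if l: "1 \<le> l" "l \<le> k" for l
      proof -
        have "hessian_const CARD('n) l * b ^ l * \<nu> \<ge> 0"
          using hessian_const_pos[of l "CARD('n)"] l k b \<nu> by simp
        then show ?thesis using ge[OF l] by linarith
      qed
      then show ?thesis by (simp add: Gamma_cone_def)
    qed
    moreover have "(- u x) powr \<alpha> \<le> p_k_Hessian k p u x"
    proof -
      have "(- u x) powr \<alpha> = \<epsilon> powr \<alpha> * z powr (- (s * \<alpha>))"
        using \<epsilon> z by (simp add: u_def profile_def z_def powr_mult powr_powr)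
      also have "\<dots> = \<kappa> * ((\<epsilon> * s * q) powr d * z powr (- ((s + 1) * d))) * \<nu>"
        unfolding \<epsilon>\<alpha> s\<alpha> by simp
      also have "(\<epsilon> * s * q) powr d * z powr (- ((s + 1) * d)) = b ^ k"
      proof -
        have "b ^ k = b powr real k" using b by (simp add: powr_realpow)
        also have "\<dots> = C powr real k * (z powr (- N)) powr real k"
          unfolding b_def by (rule powr_mult)
        also have "\<dots> = (\<epsilon> * s * q) powr d * z powr (- ((s + 1) * d))"
          by (simp add: C_def N_def powr_powr d_def mult_ac)
        finally show ?thesis ..
      qed
      also have "\<kappa> * b ^ k * \<nu> \<le> elem_sym k \<mu>"
        using ge[of k] k by (simp add: \<kappa>_def)
      also have "elem_sym k \<mu> = p_k_Hessian k p u x"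
        by (simp add: p_k_Hessian_def \<mu>(1) elem_sym_of_real)
      finally show ?thesis .
    qed
    ultimately show ?thesis using \<mu>(1) by (auto simp: eigvals_in_def)
  qed
  have "u x < 0" for x
    using \<epsilon> base_pos[of x] by (simp add: u_def profile_def mult_pos_pos)
  moreover have "u \<in> admissible p k UNIV"
    using main C1_profile C1_p_field_profile by (simp add: admissible_def u_def)
  ultimately show ?thesis using main by blast
qed

theorem theorem1p3:
  fixes k :: nat and p \<alpha> :: real
  assumes "1 \<le> k" and "k \<le> CARD('n::finite)"
    and "1 < p" and "p * real k < real CARD('n)"
  shows "(\<not> (\<exists>u \<in> admissible p k (UNIV :: (real ^ 'n) set).
            (\<forall>x. u x < 0) \<and> (\<forall>x. p_k_Hessian k p u x \<ge> (- u x) powr \<alpha>)))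
         \<longleftrightarrow> \<alpha> \<le> k_star CARD('n) k p"
proof
  assume "\<not> (\<exists>u \<in> admissible p k (UNIV :: (real ^ 'n) set).
    (\<forall>x. u x < 0) \<and> (\<forall>x. p_k_Hessian k p u x \<ge> (- u x) powr \<alpha>))"
  then show "\<alpha> \<le> k_star CARD('n) k p"
    using exists_negative_solution[OF assms, of \<alpha>] by force
next
  assume le: "\<alpha> \<le> k_star CARD('n) k p"
  show "\<not> (\<exists>u \<in> admissible p k (UNIV :: (real ^ 'n) set).
    (\<forall>x. u x < 0) \<and> (\<forall>x. p_k_Hessian k p u x \<ge> (- u x) powr \<alpha>))"
    using no_negative_solution[OF assms(1,3,4)] le by (metis not_less)
qed

end
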